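(* Let $U\subset\mathbb R^k$ be nonempty, convex and compact. Consider the problem of minimizing $J(u(\cdot)):=Y^u_0$ over $u(\cdot)\in\mathcal U[0,T]$ subject to $$\begin{cases}dX^u_t=[b_1(t)X^u_t+b_2(t)u_t+b_3(t)]dt+\sum_{i=1}^d[\sigma^i_1(t)X^u_t+\sigma^i_2(t)u_t+\sigma^i_3(t)]dW^i_t,\\ dY^u_t=-[f_1(t)X^u_t+f_2(t)Y^u_t+f_3(t,u_t)]dt+(Z^u_t)^\intercal dW_t,\\ X^u_0=x_0,\quad Y^u_T=\alpha^\intercal X^u_T+\gamma,\end{cases}$$ where $x_0,\alpha\in\mathbb R^n$, $\gamma\in\mathbb R$ and all coefficients are deterministic. Assume: (i) $b_1,b_2,b_3$, $\sigma^i_1,\sigma^i_2,\sigma^i_3$ ($i=1,\dots,d$), $f_1,f_2$ are bounded, and $|f_3(t,u)|\le L(1+|u|)$ for a given $L>0$; (ii) $f_3$ is continuously differentiable and convex in $u$; (iii) $(f_3)_u$ is bounded and Lipschitz continuous in $u$. For a given $\epsilon>0$ let $u^{m_\epsilon-1}(\cdot)$ be the control returned by the modified method of successive approximations corresponding to the permissible error $\epsilon$, as defined in the context. Then $$J(u^{m_\epsilon-1}(\cdot))-\inf_{u(\cdot)\in\mathcal U[0,T]}J(u(\cdot))\le\tilde C\epsilon^{1/2},$$ where $\tilde C$ is a positive constant independent of $\epsilon$.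
   Context: Fix $T>0$ and positive integers $n,d,k$. $(\Omega,\mathcal F,\mathbb P)$ is a complete probability space with a standard $d$-dimensional Brownian motion $W=(W^1,\dots,W^d)^\intercal$, and $\mathbb F$ is the $\mathbb P$-augmented natural filtration of $W$. $\mathcal U[0,T]$ is the set of $\mathbb F$-adapted $U$-valued processes $u(\cdot)$ with $\sup_{t\in[0,T]}\mathbb E[|u_t|^8]<\infty$; standing assumption: $\inf_{u(\cdot)\in\mathcal U[0,T]}J(u(\cdot))>-\infty$. Sizes of the coefficients: $b_1,\sigma_1^i$ are $\mathbb R^{n\times n}$-valued, $b_2,\sigma_2^i$ are $\mathbb R^{n\times k}$-valued, $b_3,\sigma_3^i$ are $\mathbb R^n$-valued, $f_1$ is $\mathbb R^{1\times n}$-valued, $f_2$ is real-valued, and $f_3:[0,T]\times U\to\mathbb R$ (all measurable in $t$). **Adjoint process and Hamiltonians.** The first-order adjoint equation of the problem reduces to the linear ODE $$p_t=\alpha+\int_t^T\big\{f_2(s)p_s+b_1(s)^\intercal p_s+f_1(s)^\intercal\big\}ds,\quad t\in[0,T],$$ (with vanishing martingale part $q=0$), the second-order adjoint process vanishes, and the Hamiltonian is $$G(t,x,y,p,v)=p^\intercal[b_1(t)x+b_2(t)v+b_3(t)]+f_1(t)x+f_2(t)y+f_3(t,v).$$ The augmented Hamiltonian with parameter $\rho\ge0$ is $$\tilde{\mathcal H}(t,x,y,p,v,u)=G(t,x,y,p,v)+\tfrac\rho2\Big\{|b_2(t)(v-u)|^2+\sum_{i=1}^d|\sigma^i_2(t)(v-u)|^2+|f_3(t,v)-f_3(t,u)|^2\Big\}.$$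 **Constants.** $C\ge0$ is a constant such that for all $u(\cdot),v(\cdot)\in\mathcal U[0,T]$, writing $\hat G(t)=G(t,X^u_t,Y^u_t,p_t,v_t)-G(t,X^u_t,Y^u_t,p_t,u_t)$, $$J(v(\cdot))-J(u(\cdot))\le e^{\|f_2\|_\infty T}\mathbb E\Big[\int_0^T\hat G^+dt\Big]-e^{-\|f_2\|_\infty T}\mathbb E\Big[\int_0^T\hat G^-dt\Big]+C\,\mathbb E\Big[\int_0^T\Big\{|b_2(v_t-u_t)|^2+\sum_{i}|\sigma_2^i(v_t-u_t)|^2+|f_3(t,v_t)-f_3(t,u_t)|^2\Big\}dt\Big].$$ The parameter satisfies $\rho>2Ce^{\|f_2\|_\infty T}$; when $C=0$ is used, $\rho=0$ is also allowed and $2C/\rho$ is read as $0$, in which case the update below is $u^m_t\in\arg\min_{u\in U}G(t,X^m_t,Y^m_t,p_t,u)$. **Algorithm and returned control.** Start from $u^0(\cdot)\in\mathcal U[0,T]$; for $m\ge1$ let $(X^m,Y^m)$ be the $(X,Y)$-components of the state corresponding to $u^{m-1}(\cdot)$ and choose $u^m(\cdot)\in\mathcal U[0,T]$ with $$u^m_t\in\arg\min_{u\in U}\tilde{\mathcal H}(t,X^m_t,Y^m_t,p_t,u,u^{m-1}_t),\quad t\in[0,T].$$ For $\epsilon>0$, $m_\epsilon$ is the smallest positive integer such that for all $m\ge m_\epsilon$ and all $u(\cdot)\in\mathcal U[0,T]$, $$\mathbb E\Big[\int_0^T\big(\tilde{\mathcal H}(t,X^m_t,Y^m_t,p_t,u_t,u^{m-1}_t)-\tilde{\mathcal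 H}(t,X^m_t,Y^m_t,p_t,u^{m-1}_t,u^{m-1}_t)\big)dt\Big]\ge-\Big(e^{-\|f_2\|_\infty T}-\frac{2C}{\rho}\Big)^{-1}\epsilon$$ (such an integer exists), and $u^{m_\epsilon-1}(\cdot)$ is the returned control. *)

theory Defs
  imports "HOL-Probability.Probability"
begin
definition natural_filtration :: "'a measure \<Rightarrow> (real \<Rightarrow> 'a \<Rightarrow> 'b::topological_space) \<Rightarrow> real \<Rightarrow> 'a measure" where
  "natural_filtration M W t =
     sigma (space M) {W s -` A \<inter> space M | s A. s \<in> {0..t} \<and> A \<in> sets borel}"

definition augmented_filtration :: "'a measure \<Rightarrow> (real \<Rightarrow> 'a \<Rightarrow> 'b::topological_space) \<Rightarrow> real \<Rightarrow> 'a measure" where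
  "augmented_filtration M W t = sigma (space M) (sets (natural_filtration M W t) \<union> null_sets M)"

definition brownian_motion :: "'a measure \<Rightarrow> real \<Rightarrow> (real \<Rightarrow> 'a \<Rightarrow> real ^ 'd) \<Rightarrow> bool" where
  "brownian_motion M T W \<longleftrightarrow>
     (\<forall>t\<in>{0..T}. W t \<in> borel_measurable M) \<and>
     (AE \<omega> in M. W 0 \<omega> = 0) \<and>
     (AE \<omega> in M. continuous_on {0..T} (\<lambda>t. W t \<omega>)) \<and>
     (\<forall>s t. 0 \<le> s \<and> s < t \<and> t \<le> T \<longrightarrow>
        distributed M lborel (\<lambda>\<omega>. W t \<omega> - W s \<omega>)
          (\<lambda>x. ennreal (\<Prod>i\<in>UNIV. normal_density 0 (sqrt (t - s)) (x $ i))) \<and>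
        prob_space.indep_set M (sets (natural_filtration M W s))
          {(\<lambda>\<omega>. W t \<omega> - W s \<omega>) -` A \<inter> space M | A. A \<in> sets borel})"

text \<open>Adapted processes are always understood to be jointly measurable in \<open>(t, \<omega>)\<close>,
  so that their time integrals make sense.\<close>

definition adapted_process ::
    "'a measure \<Rightarrow> (real \<Rightarrow> 'a measure) \<Rightarrow> real \<Rightarrow> (real \<Rightarrow> 'a \<Rightarrow> 'b::topological_space) \<Rightarrow> bool" where
  "adapted_process M F T X \<longleftrightarrow>
     (\<forall>t\<in>{0..T}. X t \<in> borel_measurable (F t)) \<and>
     (\<lambda>(t, \<omega>). X t \<omega>) \<in> borel_measurable (restrict_space borel {0..T} \<Otimes>\<^sub>M M)"

text \<open>The list \<open>[(a\<^sub>1, b\<^sub>1, \<xi>\<^sub>1), \<dots>]\<close> encodes the simple process \<open>\<Sum>j. \<xi>\<^sub>j 1\<^bsub>(a\<^sub>j, b\<^sub>j]\<^esub>\<close>; the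
  intervals may overlap.\<close>

type_synonym ('a, 'b) simple_process = "(real \<times> real \<times> ('a \<Rightarrow> 'b)) list"

definition simple_process ::
    "(real \<Rightarrow> 'a measure) \<Rightarrow> real \<Rightarrow> ('a, 'b::real_normed_vector) simple_process \<Rightarrow> bool" where
  "simple_process F T S \<longleftrightarrow>
     (\<forall>(a, b, \<xi>)\<in>set S. 0 \<le> a \<and> a \<le> b \<and> b \<le> T \<and>
        \<xi> \<in> borel_measurable (F a) \<and> bounded (\<xi> ` space (F a)))"

definition simple_value :: "('a, 'b::real_normed_vector) simple_process \<Rightarrow> real \<Rightarrow> 'a \<Rightarrow> 'b" where
  "simple_value S t \<omega> = (\<Sum>(a, b, \<xi>)\<leftarrow>S. if a < t \<and> t \<le> b then \<xi> \<omega> else 0)"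

definition simple_integral ::
    "(real \<Rightarrow> 'a \<Rightarrow> real) \<Rightarrow> ('a, 'b::real_normed_vector) simple_process \<Rightarrow> real \<Rightarrow> 'a \<Rightarrow> 'b" where
  "simple_integral B S t \<omega> = (\<Sum>(a, b, \<xi>)\<leftarrow>S. (B (min b t) \<omega> - B (min a t) \<omega>) *\<^sub>R \<xi> \<omega>)"

text \<open>\<open>I t\<close> is a version of \<open>\<integral>\<^sub>0\<^sup>t H dB\<close> for every \<open>t \<in> [0, T]\<close>, where \<open>H\<close> is square
  integrable on \<open>[0, T] \<times> \<Omega>\<close> and \<open>B\<close> is a scalar Brownian motion.\<close>

definition ito_integral_process ::
    "'a measure \<Rightarrow> (real \<Rightarrow> 'a measure) \<Rightarrow> real \<Rightarrow> (real \<Rightarrow> 'a \<Rightarrow> real) \<Rightarrow>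
     (real \<Rightarrow> 'a \<Rightarrow> 'b::euclidean_space) \<Rightarrow> (real \<Rightarrow> 'a \<Rightarrow> 'b) \<Rightarrow> bool" where
  "ito_integral_process M F T B H I \<longleftrightarrow>
     adapted_process M F T H \<and>
     (\<forall>t\<in>{0..T}. I t \<in> borel_measurable (F t)) \<and>
     (\<exists>S. (\<forall>m. simple_process F T (S m)) \<and>
        (\<lambda>m. \<integral>\<^sup>+\<omega>. (\<integral>\<^sup>+t\<in>{0..T}. ennreal ((norm (simple_value (S m) t \<omega> - H t \<omega>))\<^sup>2) \<partial>lborel) \<partial>M)
          \<longlonglongrightarrow> 0 \<and>
        (\<forall>t\<in>{0..T}. (\<lambda>m. \<integral>\<^sup>+\<omega>. ennreal ((norm (simple_integral B (S m) t \<omega> - I t \<omega>))\<^sup>2) \<partial>M)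
          \<longlonglongrightarrow> 0))"

text \<open>The space of adapted, almost surely continuous processes with
  \<open>E (sup\<^bsub>t\<le>T\<^esub> |X\<^sub>t|\<^sup>2) < \<infinity>\<close>.\<close>

definition S2_process ::
    "'a measure \<Rightarrow> (real \<Rightarrow> 'a measure) \<Rightarrow> real \<Rightarrow> (real \<Rightarrow> 'a \<Rightarrow> 'b::real_normed_vector) \<Rightarrow> bool" where
  "S2_process M F T X \<longleftrightarrow>
     adapted_process M F T X \<and>
     (AE \<omega> in M. continuous_on {0..T} (\<lambda>t. X t \<omega>)) \<and>
     (\<integral>\<^sup>+\<omega>. (SUP t\<in>{0..T}. ennreal ((norm (X t \<omega>))\<^sup>2)) \<partial>M) < \<infinity>"

text \<open>The row vector \<open>f\<^sub>1(t)\<close> is stored as a vector, and \<open>f\<^sub>1(t) x\<close> is written as an inner product.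
  Only the values for \<open>t \<in> [0, T]\<close> and, in the case of \<open>f\<^sub>3\<close>, for controls in \<open>U\<close> matter.\<close>

record ('n::finite, 'd::finite, 'k::finite) problem =
  b1 :: "real \<Rightarrow> real ^ 'n ^ 'n"
  b2 :: "real \<Rightarrow> real ^ 'k ^ 'n"
  b3 :: "real \<Rightarrow> real ^ 'n"
  \<sigma>1 :: "'d \<Rightarrow> real \<Rightarrow> real ^ 'n ^ 'n"
  \<sigma>2 :: "'d \<Rightarrow> real \<Rightarrow> real ^ 'k ^ 'n"
  \<sigma>3 :: "'d \<Rightarrow> real \<Rightarrow> real ^ 'n"
  f1 :: "real \<Rightarrow> real ^ 'n"
  f2 :: "real \<Rightarrow> real"
  f3 :: "real \<Rightarrow> real ^ 'k \<Rightarrow> real"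
  x_init :: "real ^ 'n"
  y_slope :: "real ^ 'n"      \<comment> \<open>\<open>\<alpha>\<close>\<close>
  y_const :: real             \<comment> \<open>\<open>\<gamma>\<close>\<close>

definition controls ::
    "'a measure \<Rightarrow> (real \<Rightarrow> 'a \<Rightarrow> real ^ 'd) \<Rightarrow> real \<Rightarrow> (real ^ 'k) set \<Rightarrow> (real \<Rightarrow> 'a \<Rightarrow> real ^ 'k) set" where
  "controls M W T U =
     {u. adapted_process M (augmented_filtration M W) T u \<and>
         (\<forall>t\<in>{0..T}. \<forall>\<omega>\<in>space M. u t \<omega> \<in> U) \<and>
         (SUP t\<in>{0..T}. \<integral>\<^sup>+\<omega>. ennreal (norm (u t \<omega>) ^ 8) \<partial>M) < \<infinity>}"

definition forward_solution ::
    "('n::finite, 'd::finite, 'k::finite) problem \<Rightarrow> 'a measure \<Rightarrow> (real \<Rightarrow> 'a \<Rightarrow> real ^ 'd) \<Rightarrow> real \<Rightarrow>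
     (real \<Rightarrow> 'a \<Rightarrow> real ^ 'k) \<Rightarrow> (real \<Rightarrow> 'a \<Rightarrow> real ^ 'n) \<Rightarrow> bool" where
  "forward_solution c M W T u X \<longleftrightarrow>
     S2_process M (augmented_filtration M W) T X \<and>
     (\<exists>I. (\<forall>i. ito_integral_process M (augmented_filtration M W) T (\<lambda>t \<omega>. W t \<omega> $ i)
               (\<lambda>t \<omega>. \<sigma>1 c i t *v X t \<omega> + \<sigma>2 c i t *v u t \<omega> + \<sigma>3 c i t) (I i)) \<and>
          (\<forall>t\<in>{0..T}. AE \<omega> in M.
             X t \<omega> = x_init c
               + (LINT s:{0..t}|lborel. b1 c s *v X s \<omega> + b2 c s *v u s \<omega> + b3 c s)
               + (\<Sum>i\<in>UNIV. I i t \<omega>)))"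

definition backward_solution ::
    "('n::finite, 'd::finite, 'k::finite) problem \<Rightarrow> 'a measure \<Rightarrow> (real \<Rightarrow> 'a \<Rightarrow> real ^ 'd) \<Rightarrow> real \<Rightarrow>
     (real \<Rightarrow> 'a \<Rightarrow> real ^ 'k) \<Rightarrow> (real \<Rightarrow> 'a \<Rightarrow> real ^ 'n) \<Rightarrow>
     (real \<Rightarrow> 'a \<Rightarrow> real) \<Rightarrow> (real \<Rightarrow> 'a \<Rightarrow> real ^ 'd) \<Rightarrow> bool" where
  "backward_solution c M W T u X Y Z \<longleftrightarrow>
     S2_process M (augmented_filtration M W) T Y \<and>
     adapted_process M (augmented_filtration M W) T Z \<and>
     (\<integral>\<^sup>+\<omega>. (\<integral>\<^sup>+t\<in>{0..T}. ennreal ((norm (Z t \<omega>))\<^sup>2) \<partial>lborel) \<partial>M) < \<infinity> \<and>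
     (\<exists>K. (\<forall>i. ito_integral_process M (augmented_filtration M W) T (\<lambda>t \<omega>. W t \<omega> $ i)
               (\<lambda>t \<omega>. Z t \<omega> $ i) (K i)) \<and>
          (\<forall>t\<in>{0..T}. AE \<omega> in M.
             Y t \<omega> = y_slope c \<bullet> X T \<omega> + y_const c
               + (LINT s:{t..T}|lborel. f1 c s \<bullet> X s \<omega> + f2 c s * Y s \<omega> + f3 c s (u s \<omega>))
               - (\<Sum>i\<in>UNIV. K i T \<omega> - K i t \<omega>)))"

definition state_solution ::
    "('n::finite, 'd::finite, 'k::finite) problem \<Rightarrow> 'a measure \<Rightarrow> (real \<Rightarrow> 'a \<Rightarrow> real ^ 'd) \<Rightarrow> real \<Rightarrow>
     (real \<Rightarrow> 'a \<Rightarrow> real ^ 'k) \<Rightarrow> (real \<Rightarrow> 'a \<Rightarrow> real ^ 'n) \<Rightarrow>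
     (real \<Rightarrow> 'a \<Rightarrow> real) \<Rightarrow> (real \<Rightarrow> 'a \<Rightarrow> real ^ 'd) \<Rightarrow> bool" where
  "state_solution c M W T u X Y Z \<longleftrightarrow>
     forward_solution c M W T u X \<and> backward_solution c M W T u X Y Z"

text \<open>For a solution of the backward equation, \<open>Y\<^sub>0\<close> is measurable with respect to a trivial \<open>\<sigma>\<close>-algebra, hence almost surely constant; the
  cost \<open>J(u) = Y\<^sup>u\<^sub>0\<close> is that constant.\<close>

definition initial_value :: "'a measure \<Rightarrow> (real \<Rightarrow> 'a \<Rightarrow> real) \<Rightarrow> real" where
  "initial_value M Y = (THE y. AE \<omega> in M. Y 0 \<omega> = y)"

definition cost :: "'a measure \<Rightarrow> ('u \<Rightarrow> real \<Rightarrow> 'a \<Rightarrow> real) \<Rightarrow> 'u \<Rightarrow> real" where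
  "cost M YY u = initial_value M (YY u)"

definition adjoint_solution ::
    "('n::finite, 'd::finite, 'k::finite) problem \<Rightarrow> real \<Rightarrow> (real \<Rightarrow> real ^ 'n) \<Rightarrow> bool" where
  "adjoint_solution c T p \<longleftrightarrow>
     continuous_on {0..T} p \<and>
     (\<forall>t\<in>{0..T}. p t = y_slope c
        + (LINT s:{t..T}|lborel. f2 c s *\<^sub>R p s + transpose (b1 c s) *v p s + f1 c s))"

definition hamiltonian ::
    "('n::finite, 'd::finite, 'k::finite) problem \<Rightarrow>
     real \<Rightarrow> real ^ 'n \<Rightarrow> real \<Rightarrow> real ^ 'n \<Rightarrow> real ^ 'k \<Rightarrow> real" where
  "hamiltonian c t x y p v =
     p \<bullet> (b1 c t *v x + b2 c t *v v + b3 c t) + f1 c t \<bullet> x + f2 c t * y + f3 c t v"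

definition penalty ::
    "('n::finite, 'd::finite, 'k::finite) problem \<Rightarrow> real \<Rightarrow> real ^ 'k \<Rightarrow> real ^ 'k \<Rightarrow> real" where
  "penalty c t v u =
     (norm (b2 c t *v (v - u)))\<^sup>2 + (\<Sum>i\<in>UNIV. (norm (\<sigma>2 c i t *v (v - u)))\<^sup>2)
       + \<bar>f3 c t v - f3 c t u\<bar>\<^sup>2"

definition aug_hamiltonian ::
    "('n::finite, 'd::finite, 'k::finite) problem \<Rightarrow> real \<Rightarrow>
     real \<Rightarrow> real ^ 'n \<Rightarrow> real \<Rightarrow> real ^ 'n \<Rightarrow> real ^ 'k \<Rightarrow> real ^ 'k \<Rightarrow> real" where
  "aug_hamiltonian c \<rho> t x y p v u = hamiltonian c t x y p v + \<rho> / 2 * penalty c t v u"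

definition mean_integral :: "'a measure \<Rightarrow> real \<Rightarrow> (real \<Rightarrow> 'a \<Rightarrow> real) \<Rightarrow> real" where
  "mean_integral M T g = (LINT \<omega>|M. (LINT t:{0..T}|lborel. g t \<omega>))"

definition sup_norm_on :: "real \<Rightarrow> (real \<Rightarrow> real) \<Rightarrow> real" where
  "sup_norm_on T f = (SUP t\<in>{0..T}. \<bar>f t\<bar>)"

text \<open>\<open>XX u\<close> and \<open>YY u\<close> are the state components \<open>X\<^sup>u\<close> and \<open>Y\<^sup>u\<close>; the
  iterates are \<open>u 0, u 1, \<dots>\<close>.\<close>

definition msa_iterates ::
    "('n::finite, 'd::finite, 'k::finite) problem \<Rightarrow> 'a measure \<Rightarrow> (real \<Rightarrow> 'a \<Rightarrow> real ^ 'd) \<Rightarrow> real \<Rightarrow>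
     (real ^ 'k) set \<Rightarrow> ((real \<Rightarrow> 'a \<Rightarrow> real ^ 'k) \<Rightarrow> real \<Rightarrow> 'a \<Rightarrow> real ^ 'n) \<Rightarrow>
     ((real \<Rightarrow> 'a \<Rightarrow> real ^ 'k) \<Rightarrow> real \<Rightarrow> 'a \<Rightarrow> real) \<Rightarrow> (real \<Rightarrow> real ^ 'n) \<Rightarrow> real \<Rightarrow>
     (nat \<Rightarrow> real \<Rightarrow> 'a \<Rightarrow> real ^ 'k) \<Rightarrow> bool" where
  "msa_iterates c M W T U XX YY p \<rho> u \<longleftrightarrow>
     (\<forall>m. u m \<in> controls M W T U) \<and>
     (\<forall>m\<ge>1. \<forall>t\<in>{0..T}. AE \<omega> in M.
        is_arg_min
          (\<lambda>v. aug_hamiltonian c \<rho> t (XX (u (m - 1)) t \<omega>) (YY (u (m - 1)) t \<omega>) (p t) v (u (m - 1) t \<omega>))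
          (\<lambda>v. v \<in> U) (u m t \<omega>))"

text \<open>For \<open>C = \<rho> = 0\<close> the quotient \<open>2C/\<rho>\<close> is \<open>0\<close> by the convention \<open>x / 0 = 0\<close>.\<close>

definition msa_stop ::
    "('n::finite, 'd::finite, 'k::finite) problem \<Rightarrow> 'a measure \<Rightarrow> (real \<Rightarrow> 'a \<Rightarrow> real ^ 'd) \<Rightarrow> real \<Rightarrow>
     (real ^ 'k) set \<Rightarrow> ((real \<Rightarrow> 'a \<Rightarrow> real ^ 'k) \<Rightarrow> real \<Rightarrow> 'a \<Rightarrow> real ^ 'n) \<Rightarrow>
     ((real \<Rightarrow> 'a \<Rightarrow> real ^ 'k) \<Rightarrow> real \<Rightarrow> 'a \<Rightarrow> real) \<Rightarrow> (real \<Rightarrow> real ^ 'n) \<Rightarrow> real \<Rightarrow> real \<Rightarrow>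
     (nat \<Rightarrow> real \<Rightarrow> 'a \<Rightarrow> real ^ 'k) \<Rightarrow> real \<Rightarrow> nat" where
  "msa_stop c M W T U XX YY p \<rho> C u \<epsilon> =
     (LEAST m. m > 0 \<and>
        (\<forall>l\<ge>m. \<forall>v\<in>controls M W T U.
           mean_integral M T (\<lambda>t \<omega>.
             aug_hamiltonian c \<rho> t (XX (u (l - 1)) t \<omega>) (YY (u (l - 1)) t \<omega>) (p t)
               (v t \<omega>) (u (l - 1) t \<omega>)
             - aug_hamiltonian c \<rho> t (XX (u (l - 1)) t \<omega>) (YY (u (l - 1)) t \<omega>) (p t)
               (u (l - 1) t \<omega>) (u (l - 1) t \<omega>))
           \<ge> - inverse (exp (- sup_norm_on T (f2 c) * T) - 2 * C / \<rho>) * \<epsilon>))"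

definition msa_control ::
    "('n::finite, 'd::finite, 'k::finite) problem \<Rightarrow> 'a measure \<Rightarrow> (real \<Rightarrow> 'a \<Rightarrow> real ^ 'd) \<Rightarrow> real \<Rightarrow>
     (real ^ 'k) set \<Rightarrow> ((real \<Rightarrow> 'a \<Rightarrow> real ^ 'k) \<Rightarrow> real \<Rightarrow> 'a \<Rightarrow> real ^ 'n) \<Rightarrow>
     ((real \<Rightarrow> 'a \<Rightarrow> real ^ 'k) \<Rightarrow> real \<Rightarrow> 'a \<Rightarrow> real) \<Rightarrow> (real \<Rightarrow> real ^ 'n) \<Rightarrow> real \<Rightarrow> real \<Rightarrow>
     (nat \<Rightarrow> real \<Rightarrow> 'a \<Rightarrow> real ^ 'k) \<Rightarrow> real \<Rightarrow> real \<Rightarrow> 'a \<Rightarrow> real ^ 'k" where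
  "msa_control c M W T U XX YY p \<rho> C u \<epsilon> = u (msa_stop c M W T U XX YY p \<rho> C u \<epsilon> - 1)"

end

theory Submission
  imports Defs
begin

text \<open>
  The increments of the Hamiltonian in the control variable do not depend on the state: they are
  increments of \<open>q(t, v) = p\<^sub>t \<bullet> b\<^sub>2(t) v + f\<^sub>3(t, v)\<close>, which is convex and Lipschitz in \<open>v\<close>. To
  compare the returned control \<open>u\<close> with an arbitrary control \<open>v\<close>, apply the cost inequality with
  exchanged roles to each of the \<open>N\<close> equal steps of the segment from \<open>u\<close> to \<open>v\<close>. The penalties sum
  to \<open>O(1 / N)\<close>, and by convexity the decrease of \<open>q\<close> is largest in the first step, where the stopping
  criterion bounds it by \<open>O(\<epsilon> + 1 / N\<^sup>2)\<close>. Hence \<open>J(u) - J(v) = O(N \<epsilon> + 1 / N)\<close>, and \<open>N\<close> of order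
  \<open>1 / sqrt \<epsilon>\<close> gives the rate. The stopping index exists because each iteration lowers \<open>J\<close>, which is
  bounded below, by a fixed multiple of the quantity tested by the criterion.
\<close>

section \<open>Time-averaged expectations\<close>

text \<open>On this class \<open>mean_integral\<close> is a genuine linear and monotone functional;
  for a non-integrable function the Bochner integral takes the default value 0, and additivity could
  fail. The product sigma-algebra is the one of \<open>adapted_process\<close>.\<close>

definition bounded_integrand :: "'a measure \<Rightarrow> real \<Rightarrow> (real \<Rightarrow> 'a \<Rightarrow> real) \<Rightarrow> bool" where
  "bounded_integrand M T g \<longleftrightarrow>
     (\<lambda>(t, \<omega>). g t \<omega>) \<in> borel_measurable (restrict_space borel {0..T} \<Otimes>\<^sub>M M) \<and>
     (\<exists>B. \<forall>t\<in>{0..T}. \<forall>\<omega>\<in>space M. \<bar>g t \<omega>\<bar> \<le> B)"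

lemma bounded_integrandI:
  assumes "(\<lambda>(t, \<omega>). g t \<omega>) \<in> borel_measurable (restrict_space borel {0..T} \<Otimes>\<^sub>M M)"
    and "\<And>t \<omega>. t \<in> {0..T} \<Longrightarrow> \<omega> \<in> space M \<Longrightarrow> \<bar>g t \<omega>\<bar> \<le> B"
  shows "bounded_integrand M T g"
  using assms unfolding bounded_integrand_def by blast

lemma bounded_integrand_const: "bounded_integrand M T (\<lambda>t \<omega>. a)"
  by (rule bounded_integrandI[where B = "\<bar>a\<bar>"]) auto

lemma bounded_integrand_add:
  assumes "bounded_integrand M T g" "bounded_integrand M T h"
  shows "bounded_integrand M T (\<lambda>t \<omega>. g t \<omega> + h t \<omega>)"
proof -
  obtain B D where
    B: "\<forall>t\<in>{0..T}. \<forall>\<omega>\<in>space M. \<bar>g t \<omega>\<bar> \<le> B" and D: "\<forall>t\<in>{0..T}. \<forall>\<omega>\<in>space M. \<bar>h t \<omega>\<bar> \<le> D"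
    using assms unfolding bounded_integrand_def by blast
  have m: "(\<lambda>z. case_prod g z + case_prod h z)
      \<in> borel_measurable (restrict_space borel {0..T} \<Otimes>\<^sub>M M)"
    using assms unfolding bounded_integrand_def by (intro borel_measurable_add) auto
  show ?thesis
  proof (rule bounded_integrandI[where B = "B + D"])
    fix t \<omega> assume "t \<in> {0..T}" "\<omega> \<in> space M"
    then have "\<bar>g t \<omega>\<bar> \<le> B" "\<bar>h t \<omega>\<bar> \<le> D" using B D by auto
    then show "\<bar>g t \<omega> + h t \<omega>\<bar> \<le> B + D" by linarith
  qed (use m in \<open>simp add: split_beta\<close>)
qed

lemma bounded_integrand_cmult:
  assumes "bounded_integrand M T g"
  shows "bounded_integrand M T (\<lambda>t \<omega>. a * g t \<omega>)"
proof -
  obtain B where B: "\<forall>t\<in>{0..T}. \<forall>\<omega>\<in>space M. \<bar>g t \<omega>\<bar> \<le> B"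
    using assms unfolding bounded_integrand_def by blast
  have m: "(\<lambda>z. a * case_prod g z) \<in> borel_measurable (restrict_space borel {0..T} \<Otimes>\<^sub>M M)"
    using assms unfolding bounded_integrand_def by (intro borel_measurable_times) auto
  show ?thesis
    by (rule bounded_integrandI[where B = "\<bar>a\<bar> * B"])
      (use m B in \<open>auto simp: split_beta abs_mult mult_left_mono\<close>)
qed

lemma bounded_integrand_diff:
  assumes "bounded_integrand M T g" "bounded_integrand M T h"
  shows "bounded_integrand M T (\<lambda>t \<omega>. g t \<omega> - h t \<omega>)"
  using bounded_integrand_add[OF assms(1) bounded_integrand_cmult[OF assms(2), of "-1"]] by simp

lemma bounded_integrand_max:
  assumes "bounded_integrand M T g"
  shows "bounded_integrand M T (\<lambda>t \<omega>. max 0 (g t \<omega>))"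
proof -
  obtain B where B: "\<forall>t\<in>{0..T}. \<forall>\<omega>\<in>space M. \<bar>g t \<omega>\<bar> \<le> B"
    using assms unfolding bounded_integrand_def by blast
  have m: "(\<lambda>z. max 0 (case_prod g z)) \<in> borel_measurable (restrict_space borel {0..T} \<Otimes>\<^sub>M M)"
    using assms unfolding bounded_integrand_def by (intro borel_measurable_max) auto
  show ?thesis
  proof (rule bounded_integrandI[where B = B])
    fix t \<omega> assume "t \<in> {0..T}" "\<omega> \<in> space M"
    then have "\<bar>g t \<omega>\<bar> \<le> B" using B by auto
    then show "\<bar>max 0 (g t \<omega>)\<bar> \<le> B" by linarith
  qed (use m in \<open>simp add: split_beta\<close>)
qed

lemma finite_measure_restrict_lborel_Icc: "finite_measure (restrict_space lborel {a..b::real})"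
  by (rule finite_measureI) (simp add: emeasure_restrict_space space_restrict_space emeasure_lborel_Icc_eq)

context prob_space
begin

text \<open>Fubini on a finite product measure, where bounded measurable functions are integrable.
  Linearity and monotonicity of the iterated integral can then be read off from the product
  integral.\<close>

lemma mean_integral_eq_pair:
  assumes "bounded_integrand M T g"
  shows "integrable (restrict_space lborel {0..T} \<Otimes>\<^sub>M M) (case_prod g)"
    and "mean_integral M T g = integral\<^sup>L (restrict_space lborel {0..T} \<Otimes>\<^sub>M M) (case_prod g)"
proof -
  let ?R = "restrict_space lborel {0..T}"
  interpret R: finite_measure ?R
    by (rule finite_measure_restrict_lborel_Icc)
  interpret RM: pair_sigma_finite ?R M ..
  interpret P: finite_measure "?R \<Otimes>\<^sub>M M"
    by (rule finite_measure_pair_measure) unfold_locales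
  obtain B where B: "\<forall>t\<in>{0..T}. \<forall>\<omega>\<in>space M. \<bar>g t \<omega>\<bar> \<le> B"
    using assms unfolding bounded_integrand_def by blast
  have "sets (?R \<Otimes>\<^sub>M M) = sets (restrict_space borel {0..T} \<Otimes>\<^sub>M M)"
    by (intro sets_pair_measure_cong sets_restrict_space_cong) auto
  then have m: "case_prod g \<in> borel_measurable (?R \<Otimes>\<^sub>M M)"
    using assms unfolding bounded_integrand_def by (simp cong: measurable_cong_sets)
  show i: "integrable (?R \<Otimes>\<^sub>M M) (case_prod g)"
    by (rule P.integrable_const_bound[where B = B])
      (use m B in \<open>auto intro!: AE_I2 simp: space_pair_measure space_restrict_space\<close>)
  have "(LINT t:{0..T}|lborel. g t \<omega>) = (\<integral>t. g t \<omega> \<partial>?R)" for \<omega>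
    by (subst integral_restrict_space) (auto simp: set_lebesgue_integral_def)
  then show "mean_integral M T g = integral\<^sup>L (?R \<Otimes>\<^sub>M M) (case_prod g)"
    unfolding mean_integral_def using RM.integral_snd[OF i] by simp
qed

lemma mean_integral_add:
  assumes "bounded_integrand M T g" "bounded_integrand M T h"
  shows "mean_integral M T (\<lambda>t \<omega>. g t \<omega> + h t \<omega>) = mean_integral M T g + mean_integral M T h"
  using Bochner_Integration.integral_add[OF mean_integral_eq_pair(1)[OF assms(1)] mean_integral_eq_pair(1)[OF assms(2)]]
  by (simp add: mean_integral_eq_pair(2) bounded_integrand_add assms case_prod_unfold)

lemma mean_integral_cmult: "mean_integral M T (\<lambda>t \<omega>. a * g t \<omega>) = a * mean_integral M T g"
  by (simp add: mean_integral_def)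

lemma mean_integral_diff:
  assumes "bounded_integrand M T g" "bounded_integrand M T h"
  shows "mean_integral M T (\<lambda>t \<omega>. g t \<omega> - h t \<omega>) = mean_integral M T g - mean_integral M T h"
  using mean_integral_add[OF assms(1) bounded_integrand_cmult[OF assms(2), of "-1"]]
    mean_integral_cmult[of T "-1" h] by simp

text \<open>The exceptional null set may depend on \<open>t\<close>, as it does in the argmin
  condition of \<open>msa_iterates\<close>. Since the set where \<open>g\<close> lies below
  \<open>h\<close> is product measurable, the almost sure inequality on every time slice passes to
  the product.\<close>

lemma mean_integral_mono_AE:
  assumes g: "bounded_integrand M T g" and h: "bounded_integrand M T h"
    and le: "\<And>t. t \<in> {0..T} \<Longrightarrow> AE \<omega> in M. g t \<omega> \<le> h t \<omega>"
  shows "mean_integral M T g \<le> mean_integral M T h"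
proof -
  let ?R = "restrict_space lborel {0..T}"
  interpret R: finite_measure ?R
    by (rule finite_measure_restrict_lborel_Icc)
  interpret RM: pair_sigma_finite ?R M ..
  note i = mean_integral_eq_pair[OF g] mean_integral_eq_pair[OF h]
  have m: "{z \<in> space (?R \<Otimes>\<^sub>M M). case_prod g z \<le> case_prod h z} \<in> sets (?R \<Otimes>\<^sub>M M)"
    by (rule borel_measurable_le[OF borel_measurable_integrable[OF i(1)]
          borel_measurable_integrable[OF i(3)]])
  have "AE t in ?R. AE \<omega> in M. case_prod g (t, \<omega>) \<le> case_prod h (t, \<omega>)"
    by (rule AE_I2) (simp add: space_restrict_space le)
  then have "AE z in ?R \<Otimes>\<^sub>M M. case_prod g z \<le> case_prod h z"
    by (rule RM.AE_pair_measure[OF m])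
  then show ?thesis
    unfolding i(2,4) by (rule integral_mono_AE[OF i(1,3)])
qed

lemma mean_integral_mono:
  assumes "bounded_integrand M T g" "bounded_integrand M T h"
    and "\<And>t \<omega>. t \<in> {0..T} \<Longrightarrow> \<omega> \<in> space M \<Longrightarrow> g t \<omega> \<le> h t \<omega>"
  shows "mean_integral M T g \<le> mean_integral M T h"
  using assms by (intro mean_integral_mono_AE AE_I2)

lemma mean_integral_const: "T \<ge> 0 \<Longrightarrow> mean_integral M T (\<lambda>t \<omega>. a) = a * T"
  by (simp add: mean_integral_def set_lebesgue_integral_def prob_space)

lemma mean_integral_le_const:
  assumes "T \<ge> 0" "bounded_integrand M T g"
    and "\<And>t \<omega>. t \<in> {0..T} \<Longrightarrow> \<omega> \<in> space M \<Longrightarrow> g t \<omega> \<le> a"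
  shows "mean_integral M T g \<le> a * T"
  using mean_integral_mono[OF assms(2) bounded_integrand_const assms(3)] assms(1)
  by (simp add: mean_integral_const)

lemma mean_integral_nonneg:
  assumes "T \<ge> 0" "bounded_integrand M T g"
    and "\<And>t. t \<in> {0..T} \<Longrightarrow> AE \<omega> in M. 0 \<le> g t \<omega>"
  shows "0 \<le> mean_integral M T g"
  using mean_integral_mono_AE[OF bounded_integrand_const assms(2,3)] assms(1)
  by (simp add: mean_integral_const)

end

section \<open>Approximate minimization of a convex Hamiltonian\<close>

text \<open>Both \<open>w 1\<close> and \<open>w j\<close> lie on the segment from
  \<open>w 0\<close> to \<open>w (Suc j)\<close>, at the complementary fractions
  \<open>s = 1 / (j + 1)\<close> and \<open>1 - s\<close>. Adding the two convexity inequalities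
  gives \<open>f (w 1) + f (w j) \<le> f (w 0) + f (w (Suc j))\<close>.\<close>

lemma convex_on_first_step:
  fixes f :: "'b::real_vector \<Rightarrow> real"
  assumes f: "convex_on U f" and U: "u \<in> U" "v \<in> U" and j: "j < N"
  defines "w \<equiv> \<lambda>i::nat. (1 - real i / real N) *\<^sub>R u + (real i / real N) *\<^sub>R v"
  shows "f (w j) - f (w (Suc j)) \<le> f (w 0) - f (w 1)"
proof -
  define s where "s = 1 / real (Suc j)"
  have s: "0 \<le> s" "s \<le> 1" unfolding s_def by auto
  have "convex U" using f by (rule convex_on_imp_convex)
  then have wU: "w i \<in> U" if "i \<le> N" for i
    unfolding w_def using U that by (intro convexD) (auto simp: divide_le_eq_1)
  have N: "real N > 0" using j by simp
  have c1: "s * (real (Suc j) / real N) = 1 / real N"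
    unfolding s_def using N by (simp add: field_simps)
  have c2: "(1 - s) * (real (Suc j) / real N) = real j / real N"
    unfolding left_diff_distrib c1 by (simp add: add_divide_distrib)
  have comb: "(1 - r) *\<^sub>R w 0 + r *\<^sub>R w (Suc j)
      = (1 - r * (real (Suc j) / real N)) *\<^sub>R u + (r * (real (Suc j) / real N)) *\<^sub>R v" for r
    unfolding w_def by (simp add: algebra_simps)
  have "w 1 = (1 - s) *\<^sub>R w 0 + s *\<^sub>R w (Suc j)"
    unfolding comb c1 by (simp add: w_def)
  moreover have "w j = (1 - (1 - s)) *\<^sub>R w 0 + (1 - s) *\<^sub>R w (Suc j)"
    unfolding comb c2 by (simp add: w_def)
  ultimately have "f (w 1) \<le> (1 - s) * f (w 0) + s * f (w (Suc j))"
    "f (w j) \<le> (1 - (1 - s)) * f (w 0) + (1 - s) * f (w (Suc j))"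
    using convex_onD[OF f s wU wU, of 0 "Suc j"]
      convex_onD[OF f _ _ wU wU, of "1 - s" 0 "Suc j"] s j by simp_all
  then show ?thesis by (simp add: algebra_simps)
qed

text \<open>The control problem stripped of its state equations. \<open>V\<close> is the set of
  admissible controls, \<open>q\<close> the control-dependent part of the Hamiltonian and
  \<open>pen\<close> the penalty; \<open>A\<close> bounds \<open>q\<close>, \<open>Q\<close> is the
  quadratic constant of the penalty, \<open>R\<close> bounds the diameter of \<open>U\<close>, and
  \<kappa> stands for the sup norm of \<open>f2\<close> times \<open>T\<close>.
  \<open>J_increment\<close> is the cost inequality, in which only increments of \<open>q\<close>
  remain.\<close>

locale convex_msa = prob_space M for M :: "'a measure" +
  fixes T :: real and U :: "'b::euclidean_space set" and V :: "(real \<Rightarrow> 'a \<Rightarrow> 'b) set"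
    and J :: "(real \<Rightarrow> 'a \<Rightarrow> 'b) \<Rightarrow> real"
    and q :: "real \<Rightarrow> 'b \<Rightarrow> real" and pen :: "real \<Rightarrow> 'b \<Rightarrow> 'b \<Rightarrow> real"
    and A Q R \<kappa> \<rho> C :: real
  assumes T_pos: "0 < T"
    and in_range: "\<And>u t \<omega>. u \<in> V \<Longrightarrow> t \<in> {0..T} \<Longrightarrow> \<omega> \<in> space M \<Longrightarrow> u t \<omega> \<in> U"
    and combination: "\<And>u v s. u \<in> V \<Longrightarrow> v \<in> V \<Longrightarrow> 0 \<le> s \<Longrightarrow> s \<le> 1 \<Longrightarrow>
      (\<lambda>t \<omega>. (1 - s) *\<^sub>R u t \<omega> + s *\<^sub>R v t \<omega>) \<in> V"
    and patch: "\<And>u v. u \<in> V \<Longrightarrow> v \<in> V \<Longrightarrow>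
      (\<lambda>t \<omega>. if q t (v t \<omega>) < q t (u t \<omega>) then v t \<omega> else u t \<omega>) \<in> V"
    and q_measurable: "\<And>u. u \<in> V \<Longrightarrow>
      (\<lambda>(t, \<omega>). q t (u t \<omega>)) \<in> borel_measurable (restrict_space borel {0..T} \<Otimes>\<^sub>M M)"
    and pen_measurable: "\<And>u v. u \<in> V \<Longrightarrow> v \<in> V \<Longrightarrow>
      (\<lambda>(t, \<omega>). pen t (v t \<omega>) (u t \<omega>)) \<in> borel_measurable (restrict_space borel {0..T} \<Otimes>\<^sub>M M)"
    and q_convex: "\<And>t. t \<in> {0..T} \<Longrightarrow> convex_on U (q t)"
    and q_bounded: "\<And>t v. t \<in> {0..T} \<Longrightarrow> v \<in> U \<Longrightarrow> \<bar>q t v\<bar> \<le> A"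
    and pen_nonneg: "\<And>t u v. 0 \<le> pen t v u"
    and pen_le: "\<And>t u v. t \<in> {0..T} \<Longrightarrow> u \<in> U \<Longrightarrow> v \<in> U \<Longrightarrow> pen t v u \<le> Q * (norm (v - u))\<^sup>2"
    and diameter: "\<And>u v. u \<in> U \<Longrightarrow> v \<in> U \<Longrightarrow> norm (v - u) \<le> R"
    and Q_nonneg: "0 \<le> Q" and R_nonneg: "0 \<le> R" and A_nonneg: "0 \<le> A" and C_nonneg: "0 \<le> C"
    and \<rho>: "\<rho> > 2 * C * exp \<kappa> \<or> (C = 0 \<and> \<rho> = 0)"
    and J_increment: "\<And>u v. u \<in> V \<Longrightarrow> v \<in> V \<Longrightarrow>
      J v - J u \<le> exp \<kappa> * mean_integral M T (\<lambda>t \<omega>. max 0 (q t (v t \<omega>) - q t (u t \<omega>)))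
        - exp (- \<kappa>) * mean_integral M T (\<lambda>t \<omega>. max 0 (- (q t (v t \<omega>) - q t (u t \<omega>))))
        + C * mean_integral M T (\<lambda>t \<omega>. pen t (v t \<omega>) (u t \<omega>))"
begin

text \<open>The augmented Hamiltonian at \<open>v\<close> minus its value at \<open>u\<close>: the
  state terms cancel and the penalty of \<open>u\<close> against itself is zero.\<close>

definition aug :: "real \<Rightarrow> 'b \<Rightarrow> 'b \<Rightarrow> real" where
  "aug t v u = q t v - q t u + \<rho> / 2 * pen t v u"

text \<open>The factor whose inverse scales the tolerance of the stopping criterion. For
  \<open>C = 0\<close> and \<open>\<rho> = 0\<close> the quotient is 0, so that
  \<open>exp (- \<kappa>)\<close> remains.\<close>

definition gain :: real where
  "gain = exp (- \<kappa>) - 2 * C / \<rho>"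

lemma \<rho>_nonneg: "0 \<le> \<rho>"
  using \<rho> C_nonneg by (smt (verit) exp_gt_zero mult_nonneg_nonneg)

lemma gain_pos: "0 < gain"
proof (cases "C = 0")
  case False
  then have C: "C > 0" using C_nonneg by simp
  then have r: "\<rho> > 2 * C * exp \<kappa>" using \<rho> by auto
  then have "\<rho> > 0" using C by (smt (verit) exp_gt_zero mult_pos_pos)
  then show ?thesis
    using r unfolding gain_def by (simp add: exp_minus field_simps)
next
  case True
  then show ?thesis unfolding gain_def by simp
qed

lemma pen_refl: "t \<in> {0..T} \<Longrightarrow> u \<in> U \<Longrightarrow> pen t u u = 0"
  using pen_nonneg[of t u u] pen_le[of t u u] by simp

lemma pen_le_R:
  assumes "t \<in> {0..T}" "u \<in> U" "v \<in> U"
  shows "pen t v u \<le> Q * R\<^sup>2"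
  using pen_le[OF assms] power_mono[OF diameter[OF assms(2,3)], of 2] Q_nonneg
  by (smt (verit) mult_left_mono norm_ge_zero)

lemma bounded_integrand_q:
  assumes "u \<in> V"
  shows "bounded_integrand M T (\<lambda>t \<omega>. q t (u t \<omega>))"
  using q_measurable[OF assms] by (rule bounded_integrandI) (auto intro!: q_bounded in_range[OF assms])

lemma bounded_integrand_q_diff:
  assumes "u \<in> V" "v \<in> V"
  shows "bounded_integrand M T (\<lambda>t \<omega>. q t (v t \<omega>) - q t (u t \<omega>))"
  by (intro bounded_integrand_diff bounded_integrand_q assms)

lemma bounded_integrand_descent:
  assumes "u \<in> V" "v \<in> V"
  shows "bounded_integrand M T (\<lambda>t \<omega>. max 0 (- (q t (v t \<omega>) - q t (u t \<omega>))))"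
  using bounded_integrand_max[OF bounded_integrand_q_diff[OF assms(2,1)]] by simp

lemma bounded_integrand_pen:
  assumes "u \<in> V" "v \<in> V"
  shows "bounded_integrand M T (\<lambda>t \<omega>. pen t (v t \<omega>) (u t \<omega>))"
  using pen_measurable[OF assms]
  by (rule bounded_integrandI[where B = "Q * R\<^sup>2"])
    (use pen_nonneg pen_le_R in_range assms in auto)

lemma bounded_integrand_aug:
  assumes "u \<in> V" "v \<in> V"
  shows "bounded_integrand M T (\<lambda>t \<omega>. aug t (v t \<omega>) (u t \<omega>))"
  unfolding aug_def
  by (intro bounded_integrand_add bounded_integrand_cmult bounded_integrand_q_diff
      bounded_integrand_pen assms)

lemma mean_pen_le:
  assumes uv: "u \<in> V" "v \<in> V"
    and r: "\<And>t \<omega>. t \<in> {0..T} \<Longrightarrow> \<omega> \<in> space M \<Longrightarrow> norm (v t \<omega> - u t \<omega>) \<le> r"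
  shows "mean_integral M T (\<lambda>t \<omega>. pen t (v t \<omega>) (u t \<omega>)) \<le> Q * r\<^sup>2 * T"
proof (rule mean_integral_le_const)
  fix t \<omega> assume t: "t \<in> {0..T}" "\<omega> \<in> space M"
  have "pen t (v t \<omega>) (u t \<omega>) \<le> Q * (norm (v t \<omega> - u t \<omega>))\<^sup>2"
    using pen_le in_range uv t by auto
  also have "\<dots> \<le> Q * r\<^sup>2"
    by (intro mult_left_mono power_mono r t Q_nonneg) auto
  finally show "pen t (v t \<omega>) (u t \<omega>) \<le> Q * r\<^sup>2" .
qed (use T_pos bounded_integrand_pen uv in auto)

section \<open>From the stopping test to a bound on the cost gap\<close>

definition nearly_stationary :: "real \<Rightarrow> (real \<Rightarrow> 'a \<Rightarrow> 'b) \<Rightarrow> bool" where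
  "nearly_stationary \<delta> u \<longleftrightarrow>
     (\<forall>v\<in>V. - \<delta> \<le> mean_integral M T (\<lambda>t \<omega>. aug t (v t \<omega>) (u t \<omega>)))"

text \<open>Switching back to \<open>u\<close> wherever \<open>v\<close> does not decrease \<open>q\<close> yields an admissible control, so
  the averaged stationarity condition controls the negative part pointwise.\<close>

lemma mean_descent_le:
  assumes st: "nearly_stationary \<delta> u" and uv: "u \<in> V" "v \<in> V"
    and r: "0 \<le> r" "\<And>t \<omega>. t \<in> {0..T} \<Longrightarrow> \<omega> \<in> space M \<Longrightarrow> norm (v t \<omega> - u t \<omega>) \<le> r"
  shows "mean_integral M T (\<lambda>t \<omega>. max 0 (- (q t (v t \<omega>) - q t (u t \<omega>))))
    \<le> \<delta> + \<rho> / 2 * (Q * r\<^sup>2 * T)"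
proof -
  define w where "w = (\<lambda>t \<omega>. if q t (v t \<omega>) < q t (u t \<omega>) then v t \<omega> else u t \<omega>)"
  have w: "w \<in> V" unfolding w_def by (rule patch[OF uv])
  have wr: "norm (w t \<omega> - u t \<omega>) \<le> r" if "t \<in> {0..T}" "\<omega> \<in> space M" for t \<omega>
    using r(1) r(2)[OF that] by (simp add: w_def)
  \<comment> \<open>Where the switch selects \<open>v\<close>, the increment of \<open>q\<close> is
    minus the negative part; where it keeps \<open>u\<close>, both the increment and the negative
    part are 0.\<close>
  have eq: "aug t (w t \<omega>) (u t \<omega>)
      = \<rho> / 2 * pen t (w t \<omega>) (u t \<omega>) - max 0 (- (q t (v t \<omega>) - q t (u t \<omega>)))" for t \<omega>
    by (simp add: aug_def w_def)
  have "- \<delta> \<le> mean_integral M T (\<lambda>t \<omega>. aug t (w t \<omega>) (u t \<omega>))"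
    using st w by (auto simp: nearly_stationary_def)
  also have "\<dots> = \<rho> / 2 * mean_integral M T (\<lambda>t \<omega>. pen t (w t \<omega>) (u t \<omega>))
      - mean_integral M T (\<lambda>t \<omega>. max 0 (- (q t (v t \<omega>) - q t (u t \<omega>))))"
    unfolding eq
    by (simp only: mean_integral_diff mean_integral_cmult bounded_integrand_cmult
        bounded_integrand_pen bounded_integrand_descent uv w)
  also have "\<rho> / 2 * mean_integral M T (\<lambda>t \<omega>. pen t (w t \<omega>) (u t \<omega>)) \<le> \<rho> / 2 * (Q * r\<^sup>2 * T)"
    using \<rho>_nonneg mean_pen_le[OF uv(1) w wr] by (intro mult_left_mono) auto
  finally show ?thesis by simp
qed

text \<open>This is \<open>J_increment\<close> for the move from \<open>v\<close> back to
  \<open>u\<close>: the positive part of the reversed increment of \<open>q\<close> is the negative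
  part of the original one, and the subtracted term is dropped by its sign.\<close>

lemma J_decrement_le:
  assumes "u \<in> V" "v \<in> V"
  shows "J u - J v \<le> exp \<kappa> * mean_integral M T (\<lambda>t \<omega>. max 0 (- (q t (v t \<omega>) - q t (u t \<omega>))))
    + C * mean_integral M T (\<lambda>t \<omega>. pen t (u t \<omega>) (v t \<omega>))"
proof -
  have "0 \<le> mean_integral M T (\<lambda>t \<omega>. max 0 (- (q t (u t \<omega>) - q t (v t \<omega>))))"
    using T_pos by (intro mean_integral_nonneg bounded_integrand_descent assms) auto
  then have "0 \<le> exp (- \<kappa>) * mean_integral M T (\<lambda>t \<omega>. max 0 (- (q t (u t \<omega>) - q t (v t \<omega>))))"
    by simp
  with J_increment[OF assms(2,1)] show ?thesis by simp
qed

text \<open>The penalty at distance \<open>R\<close> is of order \<open>1\<close>, but the sum of the penalties of \<open>N\<close> steps of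
  length \<open>R / N\<close> is of order \<open>1 / N\<close>, while by convexity no step decreases \<open>q\<close> more than the first.\<close>

lemma gap_le:
  assumes st: "nearly_stationary \<delta> u" and uv: "u \<in> V" "v \<in> V" and N: "N > 0"
  shows "J u - J v \<le> exp \<kappa> * real N * \<delta>
    + (exp \<kappa> * (\<rho> / 2) + C) * (Q * R\<^sup>2 * T) / real N"
proof -
  define w where "w = (\<lambda>j::nat. \<lambda>t \<omega>. (1 - real j / real N) *\<^sub>R u t \<omega> + (real j / real N) *\<^sub>R v t \<omega>)"
  have w: "w j \<in> V" if "j \<le> N" for j
    unfolding w_def using that N by (intro combination uv) (auto simp: divide_le_eq_1)
  have w0: "w 0 = u" and wN: "w N = v" using N by (auto simp: w_def)
  have step: "norm (w (Suc j) t \<omega> - w j t \<omega>) \<le> R / real N"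
    if "t \<in> {0..T}" "\<omega> \<in> space M" for j t \<omega>
  proof -
    have "w (Suc j) t \<omega> - w j t \<omega> = (1 / real N) *\<^sub>R (v t \<omega> - u t \<omega>)"
      by (simp add: w_def algebra_simps add_divide_distrib)
    then have "norm (w (Suc j) t \<omega> - w j t \<omega>) = norm (v t \<omega> - u t \<omega>) / real N" by simp
    also have "\<dots> \<le> R / real N"
      using diameter in_range uv that by (intro divide_right_mono) auto
    finally show ?thesis .
  qed
  have step': "norm (w j t \<omega> - w (Suc j) t \<omega>) \<le> R / real N"
    if "t \<in> {0..T}" "\<omega> \<in> space M" for j t \<omega>
    using step[OF that, of j] by (simp add: norm_minus_commute)
  let ?E = "Q * (R / real N)\<^sup>2 * T"
  \<comment> \<open>Stationarity is known only at \<open>u = w 0\<close>, so the criterion can be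
    used only for the first step. The step length \<open>R / N\<close> makes \<open>?E\<close> of
    order \<open>1 / N^2\<close>.\<close>
  have first: "mean_integral M T (\<lambda>t \<omega>. max 0 (- (q t (w 1 t \<omega>) - q t (w 0 t \<omega>)))) \<le> \<delta> + \<rho> / 2 * ?E"
    unfolding w0
    by (rule mean_descent_le[OF st uv(1)])
      (use w[of 1] N R_nonneg step[of _ _ 0] in \<open>auto simp: w0\<close>)
  have "J (w j) - J (w (Suc j)) \<le> exp \<kappa> * (\<delta> + \<rho> / 2 * ?E) + C * ?E" if j: "j < N" for j
  proof -
    have wj: "w j \<in> V" "w (Suc j) \<in> V" "w 0 \<in> V" "w 1 \<in> V" using w j by auto
    have "mean_integral M T (\<lambda>t \<omega>. max 0 (- (q t (w (Suc j) t \<omega>) - q t (w j t \<omega>))))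
      \<le> mean_integral M T (\<lambda>t \<omega>. max 0 (- (q t (w 1 t \<omega>) - q t (w 0 t \<omega>))))"
    proof (intro mean_integral_mono bounded_integrand_descent wj)
      fix t \<omega> assume t: "t \<in> {0..T}" "\<omega> \<in> space M"
      \<comment> \<open>Convexity, applied pointwise in time and outcome, carries the bound for the
        first step over to every later step.\<close>
      have "q t (w j t \<omega>) - q t (w (Suc j) t \<omega>) \<le> q t (w 0 t \<omega>) - q t (w 1 t \<omega>)"
        unfolding w_def by (rule convex_on_first_step[OF q_convex[OF t(1)] _ _ j]) (use in_range uv t in auto)
      then show "max 0 (- (q t (w (Suc j) t \<omega>) - q t (w j t \<omega>)))
        \<le> max 0 (- (q t (w 1 t \<omega>) - q t (w 0 t \<omega>)))" by linarith
    qed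
    also note first
    finally have "exp \<kappa> * mean_integral M T (\<lambda>t \<omega>. max 0 (- (q t (w (Suc j) t \<omega>) - q t (w j t \<omega>))))
      \<le> exp \<kappa> * (\<delta> + \<rho> / 2 * ?E)" by simp
    moreover have "C * mean_integral M T (\<lambda>t \<omega>. pen t (w j t \<omega>) (w (Suc j) t \<omega>)) \<le> C * ?E"
      by (intro mult_left_mono mean_pen_le wj step' C_nonneg)
    ultimately show ?thesis using J_decrement_le[OF wj(1,2)] by linarith
  qed
  then have "(\<Sum>j<N. J (w j) - J (w (Suc j))) \<le> real N * (exp \<kappa> * (\<delta> + \<rho> / 2 * ?E) + C * ?E)"
    using sum_bounded_above[of "{..<N}" "\<lambda>j. J (w j) - J (w (Suc j))"] by simp
  also have "(\<Sum>j<N. J (w j) - J (w (Suc j))) = J u - J v"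
    using sum_lessThan_telescope'[of "\<lambda>j. J (w j)" N] by (simp add: w0 wN)
  \<comment> \<open>\<open>N\<close> copies of \<open>?E\<close>, which contains
    \<open>1 / N^2\<close>, leave a term of order \<open>1 / N\<close>.\<close>
  also have "real N * (exp \<kappa> * (\<delta> + \<rho> / 2 * ?E) + C * ?E)
      = exp \<kappa> * real N * \<delta> + (exp \<kappa> * (\<rho> / 2) + C) * (Q * R\<^sup>2 * T) / real N"
    using N by (simp add: field_simps power2_eq_square)
  finally show ?thesis .
qed

text \<open>A crude bound from boundedness of \<open>q\<close> and of \<open>U\<close>, independent
  of any stationarity. It serves the case \<open>\<epsilon> > 1\<close>, where the square root
  exceeds 1.\<close>

lemma gap_le_const:
  assumes uv: "u \<in> V" "v \<in> V"
  shows "J u - J v \<le> exp \<kappa> * (2 * A * T) + C * (Q * R\<^sup>2 * T)"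
proof -
  have "mean_integral M T (\<lambda>t \<omega>. max 0 (- (q t (v t \<omega>) - q t (u t \<omega>)))) \<le> 2 * A * T"
  proof (intro mean_integral_le_const bounded_integrand_descent uv)
    fix t \<omega> assume t: "t \<in> {0..T}" "\<omega> \<in> space M"
    have "\<bar>q t (v t \<omega>)\<bar> \<le> A" "\<bar>q t (u t \<omega>)\<bar> \<le> A" using q_bounded in_range uv t by auto
    then show "max 0 (- (q t (v t \<omega>) - q t (u t \<omega>))) \<le> 2 * A" by linarith
  qed (use T_pos in simp)
  then have "exp \<kappa> * mean_integral M T (\<lambda>t \<omega>. max 0 (- (q t (v t \<omega>) - q t (u t \<omega>))))
    \<le> exp \<kappa> * (2 * A * T)" by simp
  moreover have "C * mean_integral M T (\<lambda>t \<omega>. pen t (u t \<omega>) (v t \<omega>)) \<le> C * (Q * R\<^sup>2 * T)"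
    by (intro mult_left_mono mean_pen_le diameter in_range uv C_nonneg)
  ultimately show ?thesis using J_decrement_le[OF uv] by linarith
qed

text \<open>For \<open>\<epsilon> \<le> 1\<close> the first two summands are the coefficients of
  \<open>N * \<epsilon>\<close> and \<open>1 / N\<close> in \<open>gap_le\<close>; the factor 2
  comes from rounding \<open>N\<close> up. For \<open>\<epsilon> > 1\<close> the second and third
  dominate the bound of \<open>gap_le_const\<close>. The final 1 makes the constant strictly
  positive.\<close>

definition rate :: real where
  "rate = exp \<kappa> * (2 * inverse gain) + (exp \<kappa> * (\<rho> / 2) + C) * (Q * R\<^sup>2 * T)
     + exp \<kappa> * (2 * A * T) + 1"

lemma rate_pos: "0 < rate"
proof -
  have "0 \<le> exp \<kappa> * (2 * inverse gain)" "0 \<le> (exp \<kappa> * (\<rho> / 2) + C) * (Q * R\<^sup>2 * T)"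
    "0 \<le> exp \<kappa> * (2 * A * T)"
    using gain_pos \<rho>_nonneg C_nonneg Q_nonneg A_nonneg T_pos by (auto intro!: mult_nonneg_nonneg)
  then show ?thesis unfolding rate_def by linarith
qed

lemma gap_le_sqrt:
  assumes \<epsilon>: "0 < \<epsilon>" and st: "nearly_stationary (inverse gain * \<epsilon>) u" and uv: "u \<in> V" "v \<in> V"
  shows "J u - J v \<le> rate * sqrt \<epsilon>"
proof -
  let ?B = "(exp \<kappa> * (\<rho> / 2) + C) * (Q * R\<^sup>2 * T)"
  have QRT: "0 \<le> Q * R\<^sup>2 * T" using Q_nonneg T_pos by auto
  have B: "0 \<le> ?B" "C * (Q * R\<^sup>2 * T) \<le> ?B"
    using \<rho>_nonneg C_nonneg QRT by (auto intro!: mult_right_mono mult_nonneg_nonneg)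
  have A: "0 \<le> exp \<kappa> * (2 * A * T)" using A_nonneg T_pos by auto
  have g: "0 \<le> exp \<kappa> * (2 * inverse gain)" using gain_pos by auto
  show ?thesis
  proof (cases "\<epsilon> \<le> 1")
    case True
    \<comment> \<open>This choice balances \<open>N * \<epsilon>\<close> against
      \<open>1 / N\<close>. Rounding up at most doubles \<open>1 / sqrt \<epsilon>\<close>, since
      that number is at least 1 here.\<close>
    define N where "N = nat \<lceil>1 / sqrt \<epsilon>\<rceil>"
    have s: "0 < sqrt \<epsilon>" "sqrt \<epsilon> \<le> 1" using \<epsilon> True by auto
    then have N_ge: "1 / sqrt \<epsilon> \<le> real N" unfolding N_def by linarith
    then have N: "N > 0" using s by (smt (verit) divide_pos_pos of_nat_0_less_iff)
    have "0 < 1 / sqrt \<epsilon>" "1 \<le> 1 / sqrt \<epsilon>" using s by (simp_all only: le_divide_eq_1_pos zero_less_divide_1_iff)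
    then have "real N \<le> 2 * (1 / sqrt \<epsilon>)" unfolding N_def by linarith
    then have "real N \<le> 2 / sqrt \<epsilon>" by simp
    then have "real N * \<epsilon> \<le> 2 / sqrt \<epsilon> * \<epsilon>" using \<epsilon> by (intro mult_right_mono) auto
    also have "\<dots> = 2 * (\<epsilon> / sqrt \<epsilon>)" by simp
    also have "\<dots> = 2 * sqrt \<epsilon>" using \<epsilon> by (simp only: real_div_sqrt)
    finally have 1: "(exp \<kappa> * inverse gain) * (real N * \<epsilon>) \<le> (exp \<kappa> * inverse gain) * (2 * sqrt \<epsilon>)"
      using gain_pos by (intro mult_left_mono) auto
    have "1 / real N \<le> sqrt \<epsilon>" using N_ge N s by (simp add: field_simps)
    then have 2: "?B * (1 / real N) \<le> ?B * sqrt \<epsilon>" using B(1) by (rule mult_left_mono)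
    have "J u - J v \<le> (exp \<kappa> * inverse gain) * (real N * \<epsilon>) + ?B * (1 / real N)"
      using gap_le[OF st uv N] by (simp add: ac_simps)
    also have "\<dots> \<le> (exp \<kappa> * inverse gain) * (2 * sqrt \<epsilon>) + ?B * sqrt \<epsilon>"
      by (intro add_mono 1 2)
    also have "\<dots> = (exp \<kappa> * (2 * inverse gain) + ?B) * sqrt \<epsilon>" by (simp add: algebra_simps)
    also have "\<dots> \<le> rate * sqrt \<epsilon>"
      unfolding rate_def using A s by (intro mult_right_mono) auto
    finally show ?thesis .
  next
    case False
    have "J u - J v \<le> rate"
      using gap_le_const[OF uv] B g unfolding rate_def by linarith
    also have "\<dots> \<le> rate * sqrt \<epsilon>" using False rate_pos by simp
    finally show ?thesis .
  qed
qed

section \<open>Descent along the iterates and existence of the stopping index\<close>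

text \<open>Where \<open>aug\<close> is nonpositive, \<open>q\<close> cannot increase, and its
  decrease is at least \<open>\<rho> / 2\<close> times the penalty. The error term
  \<open>C * pen\<close> thus consumes at most the fraction \<open>2 * C / \<rho>\<close> of the
  decrease, which leaves the factor \<open>gain\<close>.\<close>

lemma descent:
  assumes uv: "u \<in> V" "v \<in> V"
    and le: "\<And>t. t \<in> {0..T} \<Longrightarrow> AE \<omega> in M. aug t (v t \<omega>) (u t \<omega>) \<le> 0"
  shows "gain * - mean_integral M T (\<lambda>t \<omega>. aug t (v t \<omega>) (u t \<omega>)) \<le> J u - J v"
proof -
  let ?d = "\<lambda>t \<omega>. q t (v t \<omega>) - q t (u t \<omega>)" and ?p = "\<lambda>t \<omega>. pen t (v t \<omega>) (u t \<omega>)"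
  have bi: "bounded_integrand M T (\<lambda>t \<omega>. max 0 (?d t \<omega>))"
    "bounded_integrand M T (\<lambda>t \<omega>. max 0 (- ?d t \<omega>))" "bounded_integrand M T ?p"
    "bounded_integrand M T (\<lambda>t \<omega>. aug t (v t \<omega>) (u t \<omega>))"
    by (intro bounded_integrand_max bounded_integrand_q_diff bounded_integrand_descent
        bounded_integrand_pen bounded_integrand_aug uv)+
  have "J v - J u \<le> mean_integral M T
      (\<lambda>t \<omega>. exp \<kappa> * max 0 (?d t \<omega>) - exp (- \<kappa>) * max 0 (- ?d t \<omega>) + C * ?p t \<omega>)"
    using J_increment[OF uv]
    by (simp only: mean_integral_add mean_integral_diff mean_integral_cmult
        bounded_integrand_diff bounded_integrand_cmult bi)
  also have "\<dots> \<le> mean_integral M T (\<lambda>t \<omega>. gain * aug t (v t \<omega>) (u t \<omega>))"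
  proof (rule mean_integral_mono_AE)
    fix t assume t: "t \<in> {0..T}"
    show "AE \<omega> in M. exp \<kappa> * max 0 (?d t \<omega>) - exp (- \<kappa>) * max 0 (- ?d t \<omega>) + C * ?p t \<omega>
      \<le> gain * aug t (v t \<omega>) (u t \<omega>)"
      using le[OF t]
    proof (rule AE_mp, intro AE_I2 impI)
      fix \<omega> assume neg: "aug t (v t \<omega>) (u t \<omega>) \<le> 0"
      have p0: "0 \<le> \<rho> / 2 * ?p t \<omega>" using \<rho>_nonneg pen_nonneg by simp
      then have d: "?d t \<omega> \<le> 0" using neg by (simp add: aug_def)
      have m: "max 0 (?d t \<omega>) = 0" "max 0 (- ?d t \<omega>) = - ?d t \<omega>" using d by auto
      \<comment> \<open>If \<rho> is 0, the parameter condition forces \<open>C = 0\<close>, so both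
        sides vanish.\<close>
      have "C * ?p t \<omega> = 2 * C / \<rho> * (\<rho> / 2 * ?p t \<omega>)"
        using \<rho> C_nonneg by (cases "\<rho> = 0") (auto simp: mult_less_0_iff)
      also have "\<dots> \<le> 2 * C / \<rho> * (- ?d t \<omega>)"
        using neg C_nonneg \<rho>_nonneg by (intro mult_left_mono) (auto simp: aug_def)
      finally have "exp (- \<kappa>) * ?d t \<omega> + C * ?p t \<omega> \<le> gain * ?d t \<omega>"
        unfolding gain_def by (simp add: algebra_simps diff_divide_distrib)
      also have "\<dots> \<le> gain * aug t (v t \<omega>) (u t \<omega>)"
        using p0 gain_pos by (simp add: aug_def)
      finally show "exp \<kappa> * max 0 (?d t \<omega>) - exp (- \<kappa>) * max 0 (- ?d t \<omega>) + C * ?p t \<omega>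
        \<le> gain * aug t (v t \<omega>) (u t \<omega>)"
        unfolding m by (simp only: mult_zero_right mult_minus_right diff_minus_eq_add add_0_left)
    qed
  qed (intro bounded_integrand_add bounded_integrand_diff bounded_integrand_cmult bi)+
  finally show ?thesis by (simp add: mean_integral_cmult)
qed

text \<open>The amounts \<open>\<mu> m\<close> gained by the successive updates are nonnegative, and
  \<open>gain\<close> times their partial sums is bounded by a telescoping sum of costs, hence by
  \<open>J (u 0)\<close> minus a lower bound of \<open>J\<close>. They are therefore summable and
  tend to 0, and \<open>\<mu> m\<close> is the worst value that the stopping test can see at
  \<open>u m\<close>.\<close>

lemma eventually_nearly_stationary:
  fixes u :: "nat \<Rightarrow> real \<Rightarrow> 'a \<Rightarrow> 'b"
  assumes u: "\<And>m. u m \<in> V" and bdd: "bdd_below (J ` V)" and \<delta>: "0 < \<delta>"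
    and argmin: "\<And>m t. t \<in> {0..T} \<Longrightarrow>
      AE \<omega> in M. \<forall>v\<in>U. aug t (u (Suc m) t \<omega>) (u m t \<omega>) \<le> aug t v (u m t \<omega>)"
  shows "eventually (\<lambda>m. nearly_stationary \<delta> (u m)) sequentially"
proof -
  define \<mu> where "\<mu> m = - mean_integral M T (\<lambda>t \<omega>. aug t (u (Suc m) t \<omega>) (u m t \<omega>))" for m
  have neg: "AE \<omega> in M. aug t (u (Suc m) t \<omega>) (u m t \<omega>) \<le> 0" if t: "t \<in> {0..T}" for m t
    using argmin[OF t, of m]
  proof (rule AE_mp, intro AE_I2 impI)
    fix \<omega> assume w: "\<omega> \<in> space M" and h: "\<forall>v\<in>U. aug t (u (Suc m) t \<omega>) (u m t \<omega>) \<le> aug t v (u m t \<omega>)"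
    \<comment> \<open>The previous control value is itself a competitor in the minimization, and
      \<open>aug\<close> vanishes there.\<close>
    have "u m t \<omega> \<in> U" by (rule in_range[OF u t w])
    with h show "aug t (u (Suc m) t \<omega>) (u m t \<omega>) \<le> 0"
      by (force simp: aug_def pen_refl[OF t])
  qed
  have dec: "gain * \<mu> m \<le> J (u m) - J (u (Suc m))" for m
    unfolding \<mu>_def by (intro descent u neg)
  have \<mu>: "0 \<le> \<mu> m" for m
    using mean_integral_mono_AE[OF bounded_integrand_aug[OF u u] bounded_integrand_const neg[of _ m]] T_pos
    by (simp add: \<mu>_def mean_integral_const)
  obtain b where b: "\<And>v. v \<in> V \<Longrightarrow> b \<le> J v"
    using bdd unfolding bdd_below_def by auto
  have "summable (\<lambda>m. gain * \<mu> m)"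
  proof (rule summableI_nonneg_bounded)
    fix n
    have "(\<Sum>m<n. gain * \<mu> m) \<le> (\<Sum>m<n. J (u m) - J (u (Suc m)))" by (intro sum_mono dec)
    also have "\<dots> = J (u 0) - J (u n)" by (rule sum_lessThan_telescope')
    finally show "(\<Sum>m<n. gain * \<mu> m) \<le> J (u 0) - b" using b[OF u, of n] by linarith
  qed (use \<mu> gain_pos in auto)
  then have "(\<lambda>m. gain * \<mu> m) \<longlonglongrightarrow> 0" by (rule summable_LIMSEQ_zero)
  then have "(\<lambda>m. inverse gain * (gain * \<mu> m)) \<longlonglongrightarrow> inverse gain * 0" by (intro tendsto_intros)
  then have "\<mu> \<longlonglongrightarrow> 0" using gain_pos by simp
  then have "eventually (\<lambda>m. \<mu> m < \<delta>) sequentially" using \<delta> by (rule order_tendstoD)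
  then show ?thesis
  proof (rule eventually_mono)
    fix m assume m: "\<mu> m < \<delta>"
    show "nearly_stationary \<delta> (u m)"
      unfolding nearly_stationary_def
    proof
      fix v assume v: "v \<in> V"
      \<comment> \<open>The next iterate minimizes pointwise over \<open>U\<close>, so it bounds the
        test integral of every control from below.\<close>
      have "mean_integral M T (\<lambda>t \<omega>. aug t (u (Suc m) t \<omega>) (u m t \<omega>))
        \<le> mean_integral M T (\<lambda>t \<omega>. aug t (v t \<omega>) (u m t \<omega>))"
      proof (intro mean_integral_mono_AE bounded_integrand_aug u v)
        fix t assume t: "t \<in> {0..T}"
        show "AE \<omega> in M. aug t (u (Suc m) t \<omega>) (u m t \<omega>) \<le> aug t (v t \<omega>) (u m t \<omega>)"
          using argmin[OF t, of m] by (rule AE_mp) (use in_range[OF v t] in \<open>auto intro!: AE_I2\<close>)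
      qed
      then show "- \<delta> \<le> mean_integral M T (\<lambda>t \<omega>. aug t (v t \<omega>) (u m t \<omega>))"
        using m by (simp add: \<mu>_def)
    qed
  qed
qed

end

section \<open>Measurability and admissible controls\<close>

text \<open>The norm of a matrix is here the Euclidean norm of its entries; Cauchy-Schwarz is
  applied to each row.\<close>

lemma norm_matrix_vector_mult_le:
  fixes A :: "real ^ 'k ^ 'n"
  shows "norm (A *v x) \<le> norm A * norm x"
proof -
  have "norm (A *v x) \<le> L2_set (\<lambda>i. norm (A $ i) * norm x) UNIV"
    unfolding norm_vec_def[of "A *v x"]
    by (rule L2_set_mono) (simp_all add: matrix_vector_mul_component Cauchy_Schwarz_ineq2)
  also have "\<dots> = norm A * norm x"
    by (simp add: L2_set_left_distrib norm_vec_def[of A])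
  finally show ?thesis .
qed

lemma borel_measurable_matrix_vector_mult [measurable (raw)]:
  fixes A :: "'s \<Rightarrow> real ^ 'k ^ 'n" and x :: "'s \<Rightarrow> real ^ 'k"
  assumes "A \<in> borel_measurable N" "x \<in> borel_measurable N"
  shows "(\<lambda>s. A s *v x s) \<in> borel_measurable N"
  using assms
  by (rule borel_measurable_continuous_Pair)
    (auto simp: matrix_vector_mult_def intro!: continuous_intros)

text \<open>On \<open>U\<close> the map \<open>f s\<close> agrees with its McShane extension, which is a countable infimum of
  measurable functions.\<close>

lemma borel_measurable_lipschitz_compose:
  fixes f :: "'s \<Rightarrow> 'b::euclidean_space \<Rightarrow> real"
  assumes f: "\<And>v. v \<in> U \<Longrightarrow> (\<lambda>s. f s v) \<in> borel_measurable N"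
    and lip: "\<And>s v w. s \<in> space N \<Longrightarrow> v \<in> U \<Longrightarrow> w \<in> U \<Longrightarrow> \<bar>f s v - f s w\<bar> \<le> B * norm (v - w)"
    and u: "u \<in> borel_measurable N" "\<And>s. s \<in> space N \<Longrightarrow> u s \<in> U"
  shows "(\<lambda>s. f s (u s)) \<in> borel_measurable N"
proof -
  \<comment> \<open>The dense set is taken inside \<open>U\<close>, where the measurability and the
    Lipschitz bound of \<open>f\<close> are available.\<close>
  obtain D where D: "countable D" "D \<subseteq> U" "U \<subseteq> closure D"
    by (rule separable)
  define g where "g s = (INF v\<in>D. f s v + B * norm (u s - v))" for s
  have below: "f s (u s) \<le> f s v + B * norm (u s - v)" if "s \<in> space N" "v \<in> D" for s v
    using lip[OF that(1) u(2), of s v] that D(2) by fastforce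
  have "f s (u s) = g s" if s: "s \<in> space N" for s
  proof (rule antisym)
    have us: "u s \<in> U" using u(2) s by simp
    then have ne: "D \<noteq> {}" using D(3) by auto
    show "f s (u s) \<le> g s"
      unfolding g_def by (rule cINF_greatest[OF ne below[OF s]])
    show "g s \<le> f s (u s)"
    proof (rule field_le_epsilon)
      fix e :: real assume e: "0 < e"
      \<comment> \<open>The Lipschitz bound is paid twice, once in \<open>f\<close> and once in the
        added term of the infimum, so \<open>2 * \<bar>B\<bar> * r \<le> e\<close> is required. The
        summand 1 keeps the denominator positive when \<open>B = 0\<close>.\<close>
      define r where "r = e / (2 * \<bar>B\<bar> + 1)"
      have "0 < r" unfolding r_def using e by (intro divide_pos_pos) auto
      moreover have "u s \<in> closure D" using us D(3) by auto
      ultimately obtain v where v: "v \<in> D" "dist v (u s) < r"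
        unfolding closure_approachable by blast
      have "B * norm (u s - v) \<le> \<bar>B\<bar> * r"
        using v(2) by (intro mult_mono) (auto simp: dist_norm norm_minus_commute)
      moreover have "f s v \<le> f s (u s) + B * norm (u s - v)"
        using lip[OF s us, of v] v(1) D(2) by fastforce
      moreover have "2 * (\<bar>B\<bar> * r) \<le> e"
      proof -
        have "(2 * \<bar>B\<bar> + 1) * r = e" unfolding r_def by simp
        then show ?thesis using \<open>0 < r\<close> by (simp add: algebra_simps)
      qed
      moreover have "g s \<le> f s v + B * norm (u s - v)"
        unfolding g_def using below[OF s] v(1) by (intro cINF_lower bdd_belowI2) auto
      ultimately show "g s \<le> f s (u s) + e" by linarith
    qed
  qed
  moreover have "g \<in> borel_measurable N"
    unfolding g_def
  proof (rule borel_measurable_cINF[OF D(1)])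
    show "(\<lambda>s. f s v + B * norm (u s - v)) \<in> borel_measurable N" if "v \<in> D" for v
      using f[of v] that D(2) u(1) by (auto intro!: borel_measurable_add borel_measurable_times)
    show "bdd_below ((\<lambda>v. f s v + B * norm (u s - v)) ` D)" if "s \<in> space N" for s
      using below[OF that] by (intro bdd_belowI2) auto
  qed
  ultimately show ?thesis by (simp cong: measurable_cong)
qed

lemma space_augmented_filtration [simp]: "space (augmented_filtration M W t) = space M"
  by (simp add: augmented_filtration_def space_measure_of_conv)

text \<open>Values of norm at most \<open>B\<close> have eighth moment at most \<open>B ^ 8\<close>
  under a probability measure. Membership thus reduces to adaptedness and the range condition, which
  are what the constructions below verify.\<close>

lemma controls_eq_adapted:
  fixes U :: "(real ^ 'k) set"
  assumes "prob_space M" and U: "bounded U"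
  shows "controls M W T U = {u. adapted_process M (augmented_filtration M W) T u \<and>
    (\<forall>t\<in>{0..T}. \<forall>\<omega>\<in>space M. u t \<omega> \<in> U)}"
proof -
  interpret prob_space M by fact
  obtain B where B: "\<And>v. v \<in> U \<Longrightarrow> norm v \<le> B" using U by (auto simp: bounded_iff)
  have "(SUP t\<in>{0..T}. \<integral>\<^sup>+\<omega>. ennreal (norm (u t \<omega>) ^ 8) \<partial>M) < \<infinity>"
    if u: "\<forall>t\<in>{0..T}. \<forall>\<omega>\<in>space M. u t \<omega> \<in> U" for u :: "real \<Rightarrow> 'a \<Rightarrow> real ^ 'k"
  proof -
    have "(SUP t\<in>{0..T}. \<integral>\<^sup>+\<omega>. ennreal (norm (u t \<omega>) ^ 8) \<partial>M) \<le> ennreal (B ^ 8)"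
    proof (rule SUP_least)
      fix t assume t: "t \<in> {0..T}"
      have "(\<integral>\<^sup>+\<omega>. ennreal (norm (u t \<omega>) ^ 8) \<partial>M) \<le> (\<integral>\<^sup>+\<omega>. ennreal (B ^ 8) \<partial>M)"
        using B u t by (intro nn_integral_mono ennreal_leI power_mono) auto
      then show "(\<integral>\<^sup>+\<omega>. ennreal (norm (u t \<omega>) ^ 8) \<partial>M) \<le> ennreal (B ^ 8)"
        by (simp add: emeasure_space_1)
    qed
    then show ?thesis by (simp add: order.strict_trans1)
  qed
  then show ?thesis unfolding controls_def by blast
qed

lemma controls_combination:
  assumes M: "prob_space M" and U: "bounded U" "convex U"
    and uv: "u \<in> controls M W T U" "v \<in> controls M W T U" and s: "0 \<le> s" "s \<le> 1"
  shows "(\<lambda>t \<omega>. (1 - s) *\<^sub>R u t \<omega> + s *\<^sub>R v t \<omega>) \<in> controls M W T U"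
  using uv s unfolding controls_eq_adapted[OF M U(1)] adapted_process_def
  by (auto simp: split_beta intro!: borel_measurable_add borel_measurable_scaleR convexD[OF U(2)])

text \<open>Stated over an arbitrary measurable space because it serves twice: at a fixed time for
  adaptedness, and on the product space for joint measurability.\<close>

lemma borel_measurable_lipschitz_patch:
  fixes f :: "'s \<Rightarrow> 'b::euclidean_space \<Rightarrow> real"
  assumes f: "\<And>v. v \<in> U \<Longrightarrow> (\<lambda>s. f s v) \<in> borel_measurable N"
    and lip: "\<And>s v w. s \<in> space N \<Longrightarrow> v \<in> U \<Longrightarrow> w \<in> U \<Longrightarrow> \<bar>f s v - f s w\<bar> \<le> B * norm (v - w)"
    and u: "u \<in> borel_measurable N" "\<And>s. s \<in> space N \<Longrightarrow> u s \<in> U"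
    and v: "v \<in> borel_measurable N" "\<And>s. s \<in> space N \<Longrightarrow> v s \<in> U"
  shows "(\<lambda>s. if f s (v s) < f s (u s) then v s else u s) \<in> borel_measurable N"
  by (intro measurable_If u(1) v(1) borel_measurable_less
      borel_measurable_lipschitz_compose[OF f lip u] borel_measurable_lipschitz_compose[OF f lip v])

text \<open>Since \<open>q\<close> is deterministic, the switching rule at time \<open>t\<close>
  depends on the outcome only through the two control values at \<open>t\<close>, so the patched
  process remains adapted.\<close>

lemma controls_patch:
  fixes q :: "real \<Rightarrow> real ^ 'k \<Rightarrow> real"
  assumes M: "prob_space M" and U: "bounded U"
    and q: "\<And>v. v \<in> U \<Longrightarrow> (\<lambda>t. q t v) \<in> borel_measurable (restrict_space borel {0..T})"
    and lip: "\<And>t v w. t \<in> {0..T} \<Longrightarrow> v \<in> U \<Longrightarrow> w \<in> U \<Longrightarrow> \<bar>q t v - q t w\<bar> \<le> B * norm (v - w)"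
    and uv: "u \<in> controls M W T U" "v \<in> controls M W T U"
  shows "(\<lambda>t \<omega>. if q t (v t \<omega>) < q t (u t \<omega>) then v t \<omega> else u t \<omega>) \<in> controls M W T U"
proof -
  let ?N = "restrict_space borel {0..T} \<Otimes>\<^sub>M M"
  have u: "u t \<in> borel_measurable (augmented_filtration M W t)" "\<omega> \<in> space M \<Longrightarrow> u t \<omega> \<in> U"
    and v: "v t \<in> borel_measurable (augmented_filtration M W t)" "\<omega> \<in> space M \<Longrightarrow> v t \<omega> \<in> U"
    if "t \<in> {0..T}" for t \<omega>
    using uv that unfolding controls_eq_adapted[OF M U] adapted_process_def by auto
  have "(\<lambda>\<omega>. if q t (v t \<omega>) < q t (u t \<omega>) then v t \<omega> else u t \<omega>)
      \<in> borel_measurable (augmented_filtration M W t)" if t: "t \<in> {0..T}" for t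
    by (rule borel_measurable_lipschitz_patch[where U = U and f = "\<lambda>_. q t" and B = B])
      (use u[OF t] v[OF t] lip[OF t] in auto)
  moreover have "(\<lambda>z. if q (fst z) (case_prod v z) < q (fst z) (case_prod u z)
      then case_prod v z else case_prod u z) \<in> borel_measurable ?N"
  proof (rule borel_measurable_lipschitz_patch[where U = U and B = B and f = "\<lambda>z. q (fst z)"])
    show "(\<lambda>z. q (fst z) w) \<in> borel_measurable ?N" if "w \<in> U" for w
      using measurable_compose[OF measurable_fst q[OF that]] .
    show "case_prod u \<in> borel_measurable ?N" "case_prod v \<in> borel_measurable ?N"
      using uv unfolding controls_eq_adapted[OF M U] adapted_process_def by auto
  qed (use u(2) v(2) lip in \<open>auto simp: space_pair_measure space_restrict_space\<close>)
  ultimately show ?thesis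
    using u(2) v(2) unfolding controls_eq_adapted[OF M U] adapted_process_def
    by (auto simp: case_prod_unfold cong: if_cong)
qed

section \<open>The linear-convex control problem as an instance of the abstract setting\<close>

theorem theorem3p11:
  fixes c :: "('n::finite, 'd::finite, 'k::finite) problem"
    and M :: "'a measure"
    and W :: "real \<Rightarrow> 'a \<Rightarrow> real ^ 'd"
    and T L \<rho> C :: real
    and U :: "(real ^ 'k) set"
    and f3u :: "real \<Rightarrow> real ^ 'k \<Rightarrow> real ^ 'k"
    and XX :: "(real \<Rightarrow> 'a \<Rightarrow> real ^ 'k) \<Rightarrow> real \<Rightarrow> 'a \<Rightarrow> real ^ 'n"
    and YY :: "(real \<Rightarrow> 'a \<Rightarrow> real ^ 'k) \<Rightarrow> real \<Rightarrow> 'a \<Rightarrow> real"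
    and ZZ :: "(real \<Rightarrow> 'a \<Rightarrow> real ^ 'k) \<Rightarrow> real \<Rightarrow> 'a \<Rightarrow> real ^ 'd"
    and p :: "real \<Rightarrow> real ^ 'n"
  assumes T: "T > 0"
    and prob: "prob_space M" "complete_measure M"
    and bm: "brownian_motion M T W"
    and U: "U \<noteq> {}" "convex U" "compact U"
    and meas:
      "b1 c \<in> borel_measurable (restrict_space borel {0..T})"
      "b2 c \<in> borel_measurable (restrict_space borel {0..T})"
      "b3 c \<in> borel_measurable (restrict_space borel {0..T})"
      "\<And>i. \<sigma>1 c i \<in> borel_measurable (restrict_space borel {0..T})"
      "\<And>i. \<sigma>2 c i \<in> borel_measurable (restrict_space borel {0..T})"
      "\<And>i. \<sigma>3 c i \<in> borel_measurable (restrict_space borel {0..T})"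
      "f1 c \<in> borel_measurable (restrict_space borel {0..T})"
      "f2 c \<in> borel_measurable (restrict_space borel {0..T})"
      "\<And>v. v \<in> U \<Longrightarrow> (\<lambda>t. f3 c t v) \<in> borel_measurable (restrict_space borel {0..T})"
    and bdd:
      "bounded (b1 c ` {0..T})" "bounded (b2 c ` {0..T})" "bounded (b3 c ` {0..T})"
      "\<And>i. bounded (\<sigma>1 c i ` {0..T})" "\<And>i. bounded (\<sigma>2 c i ` {0..T})"
      "\<And>i. bounded (\<sigma>3 c i ` {0..T})"
      "bounded (f1 c ` {0..T})" "bounded (f2 c ` {0..T})"
    and growth: "L > 0" "\<And>t v. t \<in> {0..T} \<Longrightarrow> v \<in> U \<Longrightarrow> \<bar>f3 c t v\<bar> \<le> L * (1 + norm v)"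
    and f3_diff:
      "\<And>t v. t \<in> {0..T} \<Longrightarrow> v \<in> U \<Longrightarrow>
         (f3 c t has_derivative (\<lambda>h. f3u t v \<bullet> h)) (at v within U)"
      "\<And>t. t \<in> {0..T} \<Longrightarrow> continuous_on U (f3u t)"
    and f3_convex: "\<And>t. t \<in> {0..T} \<Longrightarrow> convex_on U (f3 c t)"
    and f3u_bdd: "bounded ((\<lambda>(t, v). f3u t v) ` ({0..T} \<times> U))"
    and f3u_lipschitz: "\<exists>K. \<forall>t\<in>{0..T}. K-lipschitz_on U (f3u t)"
    and state: "\<And>u. u \<in> controls M W T U \<Longrightarrow> state_solution c M W T u (XX u) (YY u) (ZZ u)"
    and inf_finite: "bdd_below (cost M YY ` controls M W T U)"
    and adjoint: "adjoint_solution c T p"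
    and C: "C \<ge> 0"
      "\<And>u v. u \<in> controls M W T U \<Longrightarrow> v \<in> controls M W T U \<Longrightarrow>
         (let Ghat = (\<lambda>t \<omega>. hamiltonian c t (XX u t \<omega>) (YY u t \<omega>) (p t) (v t \<omega>)
                          - hamiltonian c t (XX u t \<omega>) (YY u t \<omega>) (p t) (u t \<omega>))
          in cost M YY v - cost M YY u
             \<le> exp (sup_norm_on T (f2 c) * T) * mean_integral M T (\<lambda>t \<omega>. max 0 (Ghat t \<omega>))
               - exp (- sup_norm_on T (f2 c) * T) * mean_integral M T (\<lambda>t \<omega>. max 0 (- Ghat t \<omega>))
               + C * mean_integral M T (\<lambda>t \<omega>. penalty c t (v t \<omega>) (u t \<omega>)))"
    and \<rho>: "\<rho> > 2 * C * exp (sup_norm_on T (f2 c) * T) \<or> (C = 0 \<and> \<rho> = 0)"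
  shows "\<exists>Ct>0. \<forall>\<epsilon>>0. \<forall>u. msa_iterates c M W T U XX YY p \<rho> u \<longrightarrow>
           cost M YY (msa_control c M W T U XX YY p \<rho> C u \<epsilon>) - (INF v\<in>controls M W T U. cost M YY v)
             \<le> Ct * \<epsilon> powr (1 / 2)"
proof -
  interpret prob_space M by (rule prob(1))
  let ?I = "restrict_space borel {0..T}" and ?V = "controls M W T U" and ?J = "cost M YY"
  let ?N = "?I \<Otimes>\<^sub>M M"
  let ?\<kappa> = "sup_norm_on T (f2 c) * T"
  \<comment> \<open>The terms of the Hamiltonian that contain the control; the remaining ones cancel
    in differences taken at the same state, see \<open>H_diff\<close>.\<close>
  define q where "q t v = p t \<bullet> (b2 c t *v v) + f3 c t v" for t v
  have range: "u t \<omega> \<in> U" if "u \<in> ?V" "t \<in> {0..T}" "\<omega> \<in> space M" for u t \<omega>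
    using that by (auto simp: controls_def)
  have joint: "case_prod u \<in> borel_measurable ?N" if "u \<in> ?V" for u
    using that by (auto simp: controls_def adapted_process_def)
  have bU: "bounded U" using U(3) by (rule compact_imp_bounded)
  have p_cont: "continuous_on {0..T} p"
    using adjoint by (simp add: adjoint_solution_def)
  have [measurable]: "p \<in> borel_measurable ?I"
    by (rule borel_measurable_continuous_on_restrict[OF p_cont])
  note [measurable] = meas

  have "bounded (p ` {0..T})"
    by (intro compact_imp_bounded compact_continuous_image p_cont) auto
  then obtain P where P: "P > 0" "\<And>t. t \<in> {0..T} \<Longrightarrow> norm (p t) \<le> P"
    by (auto simp: bounded_pos)
  obtain B where B: "B > 0" "\<And>t. t \<in> {0..T} \<Longrightarrow> norm (b2 c t) \<le> B"
    using bdd(2) by (auto simp: bounded_pos)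
  \<comment> \<open>Boundedness is given for each \<sigma>2 coefficient separately, so one bound per
    index is chosen.\<close>
  have "\<exists>S. \<forall>i. \<forall>t\<in>{0..T}. norm (\<sigma>2 c i t) \<le> S i"
    using bdd(5) by (intro choice) (auto simp: bounded_iff)
  then obtain S where S: "\<And>i t. t \<in> {0..T} \<Longrightarrow> norm (\<sigma>2 c i t) \<le> S i" by blast
  obtain K where K: "K > 0" "\<And>t v. t \<in> {0..T} \<Longrightarrow> v \<in> U \<Longrightarrow> norm (f3u t v) \<le> K"
    using f3u_bdd by (auto simp: bounded_pos)
  obtain D where D: "D > 0" "\<And>v. v \<in> U \<Longrightarrow> norm v \<le> D"
    using bU by (auto simp: bounded_pos)

  \<comment> \<open>Mean value inequality on the convex set \<open>U\<close>, with the gradient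
    bounded by \<open>K\<close> uniformly in time.\<close>
  have f3_lip: "\<bar>f3 c t v - f3 c t w\<bar> \<le> K * norm (v - w)" if "t \<in> {0..T}" "v \<in> U" "w \<in> U" for t v w
    unfolding real_norm_def[symmetric]
  proof (rule differentiable_bound[OF U(2) f3_diff(1)[OF that(1)]])
    fix x assume x: "x \<in> U"
    show "onorm ((\<bullet>) (f3u t x)) \<le> K"
    proof (rule onorm_le)
      fix h
      have "norm (f3u t x \<bullet> h) \<le> norm (f3u t x) * norm h" by (simp add: Cauchy_Schwarz_ineq2)
      also have "\<dots> \<le> K * norm h" by (rule mult_right_mono[OF K(2)[OF that(1) x]]) simp
      finally show "norm (f3u t x \<bullet> h) \<le> K * norm h" .
    qed
  qed (use that in auto)
  have b2_le: "norm (b2 c t *v x) \<le> B * norm x" if "t \<in> {0..T}" for t x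
    using norm_matrix_vector_mult_le[of "b2 c t" x] B(2)[OF that]
    by (meson mult_right_mono norm_ge_zero order_trans)
  have \<sigma>2_le: "norm (\<sigma>2 c i t *v x) \<le> S i * norm x" if "t \<in> {0..T}" for i t x
    using norm_matrix_vector_mult_le[of "\<sigma>2 c i t" x] S[OF that]
    by (meson mult_right_mono norm_ge_zero order_trans)
  have inner_le: "\<bar>p t \<bullet> (b2 c t *v x)\<bar> \<le> P * B * norm x" if "t \<in> {0..T}" for t x
  proof -
    have "\<bar>p t \<bullet> (b2 c t *v x)\<bar> \<le> norm (p t) * norm (b2 c t *v x)" by (rule Cauchy_Schwarz_ineq2)
    also have "\<dots> \<le> P * (B * norm x)"
      using P B b2_le that by (intro mult_mono) auto
    finally show ?thesis by simp
  qed
  have q_diff: "q t v - q t w = p t \<bullet> (b2 c t *v (v - w)) + (f3 c t v - f3 c t w)" for t v w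
    by (simp add: q_def matrix_vector_mult_diff_distrib inner_diff_right)
  have q_lip: "\<bar>q t v - q t w\<bar> \<le> (P * B + K) * norm (v - w)" if "t \<in> {0..T}" "v \<in> U" "w \<in> U" for t v w
    using inner_le[OF that(1), of "v - w"] f3_lip[OF that] unfolding q_diff by (simp add: distrib_right)
  have q_meas: "(\<lambda>t. q t v) \<in> borel_measurable ?I" if v: "v \<in> U" for v
    unfolding q_def using meas(9)[OF v] by measurable
  have f3_meas: "(\<lambda>z. f3 c (fst z) (case_prod u z)) \<in> borel_measurable ?N" if u: "u \<in> ?V" for u
    by (rule borel_measurable_lipschitz_compose[where U = U and B = K])
      (use measurable_compose[OF measurable_fst meas(9)] f3_lip joint[OF u] range[OF u]
        in \<open>auto simp: space_pair_measure space_restrict_space\<close>)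
  have H_diff: "hamiltonian c t x y (p t) v - hamiltonian c t x y (p t) w = q t v - q t w" for t x y v w
    by (simp add: hamiltonian_def q_def inner_add_right)

  \<comment> \<open>The bound on \<open>q\<close> combines the adjoint bound \<open>P\<close>, the
    bound \<open>B\<close> on \<open>b2\<close>, the radius \<open>D\<close> of \<open>U\<close> and
    the growth of \<open>f3\<close>. The penalty constant adds the squared Lipschitz constants of
    its three parts, and \<open>2 * D\<close> bounds the diameter.\<close>
  interpret convex_msa M T U ?V ?J q "penalty c" "P * (B * D) + L * (1 + D)"
    "B\<^sup>2 + (\<Sum>i\<in>UNIV. (S i)\<^sup>2) + K\<^sup>2" "2 * D" ?\<kappa> \<rho> C
  proof
    show "0 < T" by fact
    show "\<And>u t \<omega>. u \<in> ?V \<Longrightarrow> t \<in> {0..T} \<Longrightarrow> \<omega> \<in> space M \<Longrightarrow> u t \<omega> \<in> U" by (rule range)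
    show "(\<lambda>t \<omega>. (1 - s) *\<^sub>R u t \<omega> + s *\<^sub>R v t \<omega>) \<in> ?V"
      if "u \<in> ?V" "v \<in> ?V" "0 \<le> s" "s \<le> 1" for u v s
      by (rule controls_combination[OF prob(1) bU U(2) that])
    show "(\<lambda>t \<omega>. if q t (v t \<omega>) < q t (u t \<omega>) then v t \<omega> else u t \<omega>) \<in> ?V"
      if "u \<in> ?V" "v \<in> ?V" for u v
      by (rule controls_patch[OF prob(1) bU q_meas q_lip that])
    show "(\<lambda>(t, \<omega>). q t (u t \<omega>)) \<in> borel_measurable ?N" if u: "u \<in> ?V" for u
    proof -
      have [measurable]: "case_prod u \<in> borel_measurable ?N" by (rule joint[OF u])
      note [measurable] = f3_meas[OF u]
      have "(\<lambda>z. q (fst z) (case_prod u z)) \<in> borel_measurable ?N"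
        unfolding q_def by measurable
      then show ?thesis by (simp add: split_beta)
    qed
    show "(\<lambda>(t, \<omega>). penalty c t (v t \<omega>) (u t \<omega>)) \<in> borel_measurable ?N"
      if uv: "u \<in> ?V" "v \<in> ?V" for u v
    proof -
      have [measurable]: "case_prod u \<in> borel_measurable ?N" "case_prod v \<in> borel_measurable ?N"
        by (rule joint[OF uv(1)], rule joint[OF uv(2)])
      note [measurable] = f3_meas[OF uv(1)] f3_meas[OF uv(2)]
      have "(\<lambda>z. penalty c (fst z) (case_prod v z) (case_prod u z)) \<in> borel_measurable ?N"
        unfolding penalty_def by measurable
      then show ?thesis by (simp add: split_beta)
    qed
    show "convex_on U (q t)" if "t \<in> {0..T}" for t
    proof -
      have "convex_on U (\<lambda>v. p t \<bullet> (b2 c t *v v))"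
        by (rule convex_onI)
          (auto simp: U(2) matrix_vector_right_distrib matrix_vector_mult_scaleR inner_add_right)
      then show ?thesis unfolding q_def[abs_def] by (rule convex_on_add[OF _ f3_convex[OF that]])
    qed
    show "\<bar>q t v\<bar> \<le> P * (B * D) + L * (1 + D)" if "t \<in> {0..T}" "v \<in> U" for t v
    proof -
      have "\<bar>p t \<bullet> (b2 c t *v v)\<bar> \<le> P * B * D"
        using inner_le[OF that(1), of v] D(2)[OF that(2)] P(1) B(1)
        by (smt (verit) mult_left_mono mult_pos_pos)
      moreover have "\<bar>f3 c t v\<bar> \<le> L * (1 + D)"
        using growth(2)[OF that] growth(1) D(2)[OF that(2)] by (smt (verit) mult_left_mono)
      ultimately show ?thesis unfolding q_def by (simp add: mult.assoc)
    qed
    show "0 \<le> penalty c t v u" for t v u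
      unfolding penalty_def by (auto intro!: add_nonneg_nonneg sum_nonneg)
    show "penalty c t v u \<le> (B\<^sup>2 + (\<Sum>i\<in>UNIV. (S i)\<^sup>2) + K\<^sup>2) * (norm (v - u))\<^sup>2"
      if t: "t \<in> {0..T}" "u \<in> U" "v \<in> U" for t u v
    proof -
      have "(norm (b2 c t *v (v - u)))\<^sup>2 \<le> (B * norm (v - u))\<^sup>2"
        by (intro power_mono b2_le t) auto
      moreover have "(\<Sum>i\<in>UNIV. (norm (\<sigma>2 c i t *v (v - u)))\<^sup>2) \<le> (\<Sum>i\<in>UNIV. (S i * norm (v - u))\<^sup>2)"
        by (intro sum_mono power_mono \<sigma>2_le t) auto
      moreover have "\<bar>f3 c t v - f3 c t u\<bar>\<^sup>2 \<le> (K * norm (v - u))\<^sup>2"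
        by (intro power_mono f3_lip t) auto
      ultimately show ?thesis
        unfolding penalty_def by (simp add: power_mult_distrib distrib_right sum_distrib_right)
    qed
    show "norm (v - u) \<le> 2 * D" if "u \<in> U" "v \<in> U" for u v
      using norm_triangle_ineq4[of v u] D(2)[OF that(1)] D(2)[OF that(2)] by linarith
    show "0 \<le> B\<^sup>2 + (\<Sum>i\<in>UNIV. (S i)\<^sup>2) + K\<^sup>2" by (auto intro!: add_nonneg_nonneg sum_nonneg)
    show "0 \<le> 2 * D" "0 \<le> P * (B * D) + L * (1 + D)" "0 \<le> C"
      using D(1) P(1) B(1) growth(1) C(1) by auto
    show "2 * C * exp ?\<kappa> < \<rho> \<or> C = 0 \<and> \<rho> = 0" by (rule \<rho>)
    show "?J v - ?J u \<le> exp ?\<kappa> * mean_integral M T (\<lambda>t \<omega>. max 0 (q t (v t \<omega>) - q t (u t \<omega>)))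
        - exp (- ?\<kappa>) * mean_integral M T (\<lambda>t \<omega>. max 0 (- (q t (v t \<omega>) - q t (u t \<omega>))))
        + C * mean_integral M T (\<lambda>t \<omega>. penalty c t (v t \<omega>) (u t \<omega>))" if "u \<in> ?V" "v \<in> ?V" for u v
      using C(2)[OF that] unfolding Let_def H_diff by simp
  qed

  have aug_diff: "aug_hamiltonian c \<rho> t x y (p t) v u - aug_hamiltonian c \<rho> t x y (p t) u u = aug t v u"
    for t x y v u
    using H_diff[of t x y v u] by (simp add: aug_hamiltonian_def aug_def penalty_def)
  \<comment> \<open>\<open>is_arg_min\<close> excludes strictly smaller values, so strict comparison
    is what has to be transferred to \<open>aug\<close>.\<close>
  have aug_less: "aug_hamiltonian c \<rho> t x y (p t) v u < aug_hamiltonian c \<rho> t x y (p t) w u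
      \<longleftrightarrow> aug t v u < aug t w u" for t x y v w u
    using aug_diff[of t x y v u] aug_diff[of t x y w u] by linarith
  have "cost M YY (msa_control c M W T U XX YY p \<rho> C u \<epsilon>) - (INF v\<in>?V. cost M YY v) \<le> rate * \<epsilon> powr (1 / 2)"
    if \<epsilon>: "\<epsilon> > 0" and u: "msa_iterates c M W T U XX YY p \<rho> u" for \<epsilon> u
  proof -
    have uV: "u m \<in> ?V" for m using u by (simp add: msa_iterates_def)
    let ?\<delta> = "inverse gain * \<epsilon>"
    define m where "m = msa_stop c M W T U XX YY p \<rho> C u \<epsilon>"
    \<comment> \<open>The concrete stopping test at index \<open>l\<close> is near stationarity of
      \<open>u (l - 1)\<close> with tolerance \<open>\<epsilon> / gain\<close>; the two forms differ
      only in the placement of minus signs.\<close>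
    have m_eq: "m = (LEAST m. m > 0 \<and> (\<forall>l\<ge>m. nearly_stationary ?\<delta> (u (l - 1))))"
      unfolding m_def msa_stop_def aug_diff nearly_stationary_def gain_def
      by (simp only: mult_minus_left)
    have "eventually (\<lambda>m. nearly_stationary ?\<delta> (u m)) sequentially"
    proof (rule eventually_nearly_stationary[OF uV inf_finite])
      show "0 < ?\<delta>" using \<epsilon> gain_pos by simp
      fix m t assume t: "t \<in> {0..T}"
      have "AE \<omega> in M. is_arg_min (\<lambda>v. aug_hamiltonian c \<rho> t (XX (u m) t \<omega>) (YY (u m) t \<omega>) (p t) v
          (u m t \<omega>)) (\<lambda>v. v \<in> U) (u (Suc m) t \<omega>)"
        using conjunct2[OF u[unfolded msa_iterates_def], rule_format, of "Suc m" t] t by simp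
      then show "AE \<omega> in M. \<forall>v\<in>U. aug t (u (Suc m) t \<omega>) (u m t \<omega>) \<le> aug t v (u m t \<omega>)"
        by (rule eventually_mono) (simp add: is_arg_min_def aug_less, meson not_less)
    qed
    then obtain N where "\<And>m. m \<ge> N \<Longrightarrow> nearly_stationary ?\<delta> (u m)"
      by (auto simp: eventually_sequentially)
    \<comment> \<open>The test at index \<open>l\<close> concerns the iterate \<open>l - 1\<close>,
      hence the shift from \<open>N\<close> to \<open>Suc N\<close>. This witness ensures that the
      \<open>LEAST\<close> in the stopping rule has the property it selects for.\<close>
    then have "Suc N > 0 \<and> (\<forall>l\<ge>Suc N. nearly_stationary ?\<delta> (u (l - 1)))"
      by (metis Suc_le_D diff_Suc_1 Suc_le_mono zero_less_Suc)
    then have "m > 0 \<and> (\<forall>l\<ge>m. nearly_stationary ?\<delta> (u (l - 1)))"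
      unfolding m_eq by (rule LeastI)
    \<comment> \<open>The test at \<open>l = m\<close> concerns exactly the returned control
      \<open>u (m - 1)\<close>.\<close>
    then have st: "nearly_stationary ?\<delta> (u (m - 1))" by blast
    have "?J (u (m - 1)) - rate * sqrt \<epsilon> \<le> (INF v\<in>?V. ?J v)"
    proof (rule cINF_greatest)
      show "?V \<noteq> {}" using uV by blast
      show "?J (u (m - 1)) - rate * sqrt \<epsilon> \<le> ?J v" if "v \<in> ?V" for v
        using gap_le_sqrt[OF \<epsilon> st uV that] by linarith
    qed
    then show ?thesis
      using \<epsilon> by (simp add: msa_control_def m_def[symmetric] powr_half_sqrt)
  qed
  \<comment> \<open>The witness \<open>rate\<close> is built from the problem data, \<rho> and
    \<open>C\<close> alone, so one constant serves all tolerances and all iterate sequences.\<close>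
  then show ?thesis using rate_pos by blast
qed

end
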